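(* Let $\Phi=\{\phi_\ell(x)=Ax+a_\ell\}_{\ell=1}^m$ be an integral affine IFS on $\mathbb{R}^d$ with $\|A\|<1$, let $\mu$ be the self-affine measure associated with $\Phi$ and a strictly positive probability vector $\boldsymbol{p}=(p_\ell)_{\ell=1}^m$, and let $\mathbf{M}$ be the finite nonnegative matrix constructed from $\Phi$, $\boldsymbol{p}$ and a radius $R$ as described in the context. Then $$\tau_A(\mu,2)=\frac{d\,\log\rho(\mathbf{M})}{\log|\det(A)|},$$ where $\rho(\cdot)$ denotes spectral radius. Consequently, $\mu$ is absolutely continuous (with respect to Lebesgue measure on $\mathbb{R}^d$) if and only if $\rho(\mathbf{M})=|\det(A)|$.
   Context: An integral affine IFS on $\mathbb{R}^d$ is a finite family $\Phi=\{\phi_\ell(x)=Ax+a_\ell\}_{\ell=1}^m$ with $A\in GL_d(\mathbb{R})$ of spectral radius less than $1$, $A^{-1}$ an integer matrix, and $a_\ell\in\mathbb{Z}^d$ for all $\ell$. Here $\|A\|$ is the operator norm for the Euclidean norm; the assumption $\|A\|<1$ can always be achieved by replacing $\Phi$ with a suitable iterate. The self-affine measure associated with $\Phi$ and $\boldsymbol{p}$ is the unique Borel probability measure $\mu$ on $\mathbb{R}^d$ with $\mu=\sum_{\ell=1}^m p_\ell\,\mu\circ\phi_\ell^{-1}$. The $L^{(A,2)}$-dimension of $\mu$ is $$\tau_A(\mu,2)=\liminf_{n\to\infty}\frac{d}{n\log|\det(A)|}\log\Big(\sum_{Q\in\mathcal{D}}\mu(A^nQ)^2\Big),\qquad \mathcal{D}=\{[0,1)^d+z:z\in\mathbb{Z}^d\}.$$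 Construction of $\mathbf{M}$. Let $B(0,R)$ be the closed ball of radius $R$ centered at the origin. Fix $R>0$ sufficiently large so that $\phi_\ell(B(0,R))\subset B(0,R)$ for all $1\le\ell\le m$. Let $\mathcal{A}=\{a_i-a_j:1\le i,j\le m\}$, $$\Lambda=\Big\{\sum_{k=1}^nA^{-k}\varepsilon_k: n\in\mathbb{N},\ \varepsilon_k\in\mathcal{A}\text{ for }1\le k\le n\Big\}\subset\mathbb{Z}^d,$$ and let $\Omega=B(0,R)\cap\Lambda=\{v_1,\dots,v_N\}$, $N=\#\Omega$, be an enumeration of this finite set with $v_1=0$. For $1\le r,r'\le N$ let $$\mathcal{E}_{r,r'}=\{(i,j)\in\{1,\dots,m\}^2: v_{r'}=A^{-1}(v_r+a_i-a_j)\}.$$ Then $\mathbf{M}=(\mathbf{M}_{r,r'})_{1\le r,r'\le N}$ is the $N\times N$ matrix with $\mathbf{M}_{r,r'}=\sum_{(i,j)\in\mathcal{E}_{r,r'}}p_ip_j$ if $\mathcal{E}_{r,r'}\neq\emptyset$, and $\mathbf{M}_{r,r'}=0$ otherwise.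
   Formalization: Besides φ_ℓ(B(0,R))⊂B(0,R), the radius R must also make B(0,R) invariant under x↦Ax+a_i−a_j (true for all radii ≥2R once R satisfies the first condition); without this the formula fails, e.g. d=1, A=1/2, a=(−3,−1,0,1,3), uniform p, R=6. *)

theory Defs
  imports "HOL-Probability.Probability" "Jordan_Normal_Form.Spectral_Radius"
begin

text \<open>Both libraries declare \<open>mat\<close>, \<open>det\<close> and an infix dollar sign. Below, objects on
  \<open>real^'n\<close> use the HOL-Analysis versions (qualified where needed), while the transition matrix, whose
  size is a computed number, is a Jordan_Normal_Form matrix.\<close>

text \<open>The maximum is over all complex eigenvalues of the real matrix.\<close>

definition real_spectral_radius :: "real^'n^'n \<Rightarrow> real" where
  "real_spectral_radius A =
     Max {cmod k | k. \<exists>x :: complex^'n. x \<noteq> 0 \<and>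
            (\<chi> i j. complex_of_real (vec_nth (vec_nth A i) j)) *v x = k *s x}"

definition int_vec :: "real^'n \<Rightarrow> bool" where
  "int_vec x \<longleftrightarrow> (\<forall>i. vec_nth x i \<in> \<int>)"

text \<open>The index set of a family is \<open>{1..m}\<close>; the maps need not be distinct.\<close>

definition ifs_map :: "real^'n^'n \<Rightarrow> (nat \<Rightarrow> real^'n) \<Rightarrow> nat \<Rightarrow> real^'n \<Rightarrow> real^'n" where
  "ifs_map A a l = (\<lambda>x. A *v x + a l)"

definition integral_affine_IFS :: "real^'n^'n \<Rightarrow> (nat \<Rightarrow> real^'n) \<Rightarrow> nat \<Rightarrow> bool" where
  "integral_affine_IFS A a m \<longleftrightarrow>
     invertible A \<and> real_spectral_radius A < 1 \<and>
     (\<forall>i. int_vec (vec_nth (matrix_inv A) i)) \<and>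
     (\<forall>l\<in>{1..m}. int_vec (a l))"

text \<open>By Hutchinson's theorem exactly one measure has this property when \<open>A\<close> is contracting and
  \<open>p\<close> is a probability vector.\<close>

definition self_affine_measure ::
  "real^'n^'n \<Rightarrow> (nat \<Rightarrow> real^'n) \<Rightarrow> nat \<Rightarrow> (nat \<Rightarrow> real) \<Rightarrow> (real^'n) measure \<Rightarrow> bool" where
  "self_affine_measure A a m p \<mu> \<longleftrightarrow>
     prob_space \<mu> \<and> sets \<mu> = sets borel \<and>
     (\<forall>E\<in>sets borel. measure \<mu> E = (\<Sum>l=1..m. p l * measure \<mu> (ifs_map A a l -` E)))"

definition unit_cubes :: "(real^'n) set set" where
  "unit_cubes = {{x. \<forall>i. vec_nth z i \<le> vec_nth x i \<and> vec_nth x i < vec_nth z i + 1} | z. int_vec z}"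

text \<open>The linear map is iterated as a function, because \<open>A ^ n\<close> on \<open>real^'n^'n\<close> is the entrywise
  power.\<close>

definition L2_dimension :: "real^'n^'n \<Rightarrow> (real^'n) measure \<Rightarrow> ereal" where
  "L2_dimension A \<mu> =
     liminf (\<lambda>n. ereal (real CARD('n) / (real n * ln \<bar>Determinants.det A\<bar>) *
       ln (\<Sum>\<^sub>\<infinity>Q\<in>unit_cubes. (measure \<mu> ((((*v) A) ^^ n) ` Q))\<^sup>2)))"

definition difference_set :: "(nat \<Rightarrow> real^'n) \<Rightarrow> nat \<Rightarrow> (real^'n) set" where
  "difference_set a m = {a i - a j | i j. i \<in> {1..m} \<and> j \<in> {1..m}}"

definition Lambda :: "real^'n^'n \<Rightarrow> (nat \<Rightarrow> real^'n) \<Rightarrow> nat \<Rightarrow> (real^'n) set" where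
  "Lambda A a m =
     {\<Sum>k=1..n. (((*v) (matrix_inv A)) ^^ k) (\<epsilon> k) | n \<epsilon>. \<forall>k\<in>{1..n}. \<epsilon> k \<in> difference_set a m}"

definition Omega :: "real^'n^'n \<Rightarrow> (nat \<Rightarrow> real^'n) \<Rightarrow> nat \<Rightarrow> real \<Rightarrow> (real^'n) set" where
  "Omega A a m R = cball 0 R \<inter> Lambda A a m"

text \<open>Invariance of the ball under the maps of the IFS does not suffice for the dimension formula:
  the states are differences of points of the attractor, so the ball also has to be invariant under
  the maps \<open>x \<mapsto> A x + a i - a j\<close>. For example, on the line with \<open>A = 1/2\<close>, translations
  \<open>-3, -1, 0, 1, 3\<close> and equal weights, the radius 6 only satisfies the first condition, and it loses the
  state \<open>8\<close> of the recurrent path \<open>0, 8, 4, 0\<close>. If the first condition holds for \<open>R\<close>, then both hold for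
  every radius from \<open>2 * R\<close> on.\<close>

definition admissible_radius :: "real^'n^'n \<Rightarrow> (nat \<Rightarrow> real^'n) \<Rightarrow> nat \<Rightarrow> real \<Rightarrow> bool" where
  "admissible_radius A a m R \<longleftrightarrow>
     0 < R \<and>
     (\<forall>l\<in>{1..m}. ifs_map A a l ` cball 0 R \<subseteq> cball 0 R) \<and>
     (\<forall>d\<in>difference_set a m. (\<lambda>x. A *v x + d) ` cball 0 R \<subseteq> cball 0 R)"

lemma admissible_radius_large:
  fixes A :: "real^'n^'n"
  assumes A: "onorm ((*v) A) < 1"
    and R: "0 < R" "\<forall>l\<in>{1..m}. ifs_map A a l ` cball 0 R \<subseteq> cball 0 R"
    and S: "2 * R \<le> S"
  shows "admissible_radius A a m S"
proof -
  have step: "norm (A *v x + c) \<le> t"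
    if r: "0 < r" "\<And>y. norm y \<le> r \<Longrightarrow> norm (A *v y + c) \<le> r" and t: "r \<le> t" "norm x \<le> t"
    for r t x c
  proof -
    define y where "y = (r / t) *\<^sub>R x"
    have tp: "0 < t" using r t by simp
    have "norm y = r / t * norm x" using r tp by (simp add: y_def)
    also have "\<dots> \<le> r / t * t" using r tp t by (intro mult_left_mono) auto
    finally have ny: "norm y \<le> r" using tp by simp
    have "norm (x - y) = (1 - r / t) * norm x"
    proof -
      have "x - y = (1 - r / t) *\<^sub>R x" by (simp add: y_def algebra_simps)
      then show ?thesis using t tp by simp
    qed
    also have "\<dots> \<le> (1 - r / t) * t" using t tp by (intro mult_left_mono) auto
    also have "\<dots> = t - r" using tp by (simp add: field_simps)
    finally have nd: "norm (x - y) \<le> t - r" .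
    have "norm (A *v (x - y)) \<le> onorm ((*v) A) * norm (x - y)"
      by (rule onorm) simp
    also have "\<dots> \<le> 1 * norm (x - y)" using A by (intro mult_right_mono) auto
    finally have "norm (A *v (x - y)) \<le> t - r" using nd by simp
    moreover have "A *v x + c = (A *v y + c) + A *v (x - y)"
      by (simp add: matrix_vector_mult_diff_distrib)
    ultimately have "norm (A *v x + c) \<le> r + (t - r)"
      using r(2)[OF ny] by (simp only: norm_triangle_mono)
    then show ?thesis by simp
  qed
  have inv: "norm (A *v y + a l) \<le> R" if "l \<in> {1..m}" "norm y \<le> R" for l y
    using R(2) that by (force simp: ifs_map_def image_subset_iff)
  have inv2: "norm (A *v y + (a i - a j)) \<le> 2 * R"
    if ij: "i \<in> {1..m}" "j \<in> {1..m}" and y: "norm y \<le> 2 * R" for i j y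
  proof -
    define u where "u = (1 / 2) *\<^sub>R y"
    have u: "norm u \<le> R" "norm (- u) \<le> R" using y by (auto simp: u_def)
    have y2: "y = u + u" by (simp add: u_def flip: scaleR_add_left)
    have "A *v y = A *v (u - (- u))" by (simp only: y2 diff_minus_eq_add)
    also have "\<dots> = A *v u - A *v (- u)" by (rule matrix_vector_mult_diff_distrib)
    finally have "A *v y + (a i - a j) = (A *v u + a i) - (A *v (- u) + a j)" by simp
    then have "norm (A *v y + (a i - a j)) \<le> norm (A *v u + a i) + norm (A *v (- u) + a j)"
      by (simp only: norm_triangle_ineq4)
    then show ?thesis using inv[OF ij(1) u(1)] inv[OF ij(2) u(2)] by linarith
  qed
  have 1: "norm (A *v x + a l) \<le> S" if "l \<in> {1..m}" "norm x \<le> S" for l x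
  proof (rule step[of R])
    show "R \<le> S" using R S by simp
  qed (use R that inv in blast)+
  have 2: "norm (A *v x + (a i - a j)) \<le> S"
    if "i \<in> {1..m}" "j \<in> {1..m}" "norm x \<le> S" for i j x
  proof (rule step[of "2 * R"])
    show "0 < 2 * R" using R by simp
  qed (use S that inv2 in blast)+
  show ?thesis
    unfolding admissible_radius_def
  proof (intro conjI ballI subsetI)
    show "0 < S" using R S by simp
  next
    fix l y assume "l \<in> {1..m}" "y \<in> ifs_map A a l ` cball 0 S"
    then show "y \<in> cball 0 S" using 1 by (auto simp: ifs_map_def)
  next
    fix d y assume "d \<in> difference_set a m" "y \<in> (\<lambda>x. A *v x + d) ` cball 0 S"
    then obtain i j x where "i \<in> {1..m}" "j \<in> {1..m}" "norm x \<le> S" "y = A *v x + (a i - a j)"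
      unfolding difference_set_def by auto
    then show "y \<in> cball 0 S" using 2 by simp
  qed
qed

text \<open>The states \<open>v 0, \<dots>, v (N - 1)\<close> are numbered from zero, following the indexing of
  Jordan_Normal_Form matrices.\<close>

definition edges ::
  "real^'n^'n \<Rightarrow> (nat \<Rightarrow> real^'n) \<Rightarrow> nat \<Rightarrow> (nat \<Rightarrow> real^'n) \<Rightarrow> nat \<Rightarrow> nat \<Rightarrow> (nat \<times> nat) set" where
  "edges A a m v r r' =
     {(i, j). i \<in> {1..m} \<and> j \<in> {1..m} \<and> v r' = matrix_inv A *v (v r + a i - a j)}"

definition transition_matrix ::
  "real^'n^'n \<Rightarrow> (nat \<Rightarrow> real^'n) \<Rightarrow> nat \<Rightarrow> (nat \<Rightarrow> real) \<Rightarrow> nat \<Rightarrow> (nat \<Rightarrow> real^'n) \<Rightarrow> real Matrix.mat"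
  where
  "transition_matrix A a m p N v =
     Matrix.mat N N (\<lambda>(r, r'). \<Sum>(i, j)\<in>edges A a m v r r'. p i * p j)"

end

theory Submission
  imports Defs
begin

text \<open>
  Write \<open>S n\<close> for the sum of \<open>\<mu>(A^n Q)^2\<close> over the unit cubes, \<open>\<delta>\<close> for \<open>|det A|\<close> and \<open>P n\<close> for the law of
  the integer vector \<open>A^(-n) \<phi>_w(0)\<close>, \<open>w\<close> a random word of length \<open>n\<close>. Self-affinity makes
  \<open>z \<mapsto> \<mu>(A^n Q_z)\<close> the convolution of \<open>P n\<close> with \<open>z \<mapsto> \<mu>(Q_z)\<close>, so \<open>S n\<close> is comparable to
  \<open>\<parallel>P n\<parallel>^2\<close> (the \<open>\<ell>2\<close> norm), which is the entry \<open>(0, 0)\<close> of \<open>M^n\<close>. The other entries of \<open>M^n\<close> are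
  autocorrelations of \<open>P n\<close>, hence no larger. So \<open>\<rho>(M)^n / N \<le> \<parallel>P n\<parallel>^2 \<le> \<rho>(M)^n\<close>, without any
  irreducibility of \<open>M\<close>; this gives the dimension.

  By the Cauchy-Schwarz inequality, \<open>\<mu>(K)^2\<close> is asymptotically at most \<open>Leb(V) S n / \<delta>^n\<close> for \<open>K\<close>
  compact inside \<open>V\<close> open. Hence \<open>\<delta> \<le> \<rho>(M)\<close>, and equality implies absolute continuity.
  Conversely, let \<open>\<mu>\<close> be absolutely continuous and \<open>F\<close> be invariant under integer translations. Then
  \<open>\<mu>(F) = \<mu>(A^n F)\<close>, while \<open>A^n F\<close> becomes equidistributed, so \<open>\<mu>(F)\<close> is at most the density of \<open>F\<close>.
  With \<open>F\<close> the union of the translates of \<open>A^n Q\<close> this gives \<open>\<mu>(A^n Q) \<le> \<delta>^n\<close>, whence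
  \<open>S n \<le> \<delta>^n\<close> and \<open>\<rho>(M) \<le> \<delta>\<close>.
\<close>

section \<open>Powers of complex matrices\<close>

lemma pow_mat_add:
  fixes M :: "'a::semiring_1 Matrix.mat"
  assumes "M \<in> carrier_mat N N"
  shows "M ^\<^sub>m (j + k) = M ^\<^sub>m j * M ^\<^sub>m k"
  by (induction k) (use assms in \<open>simp_all add: assoc_mult_mat[of _ N N _ N _ N]\<close>)

lemma pow_smult_mat:
  fixes M :: "'a::comm_semiring_1 Matrix.mat"
  assumes "M \<in> carrier_mat N N"
  shows "(c \<cdot>\<^sub>m M) ^\<^sub>m k = c ^ k \<cdot>\<^sub>m M ^\<^sub>m k"
proof (induction k)
  case (Suc k)
  have Mk: "M ^\<^sub>m k \<in> carrier_mat N N"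
    using assms by simp
  have "(c \<cdot>\<^sub>m M) ^\<^sub>m Suc k = (c ^ k \<cdot>\<^sub>m M ^\<^sub>m k) * (c \<cdot>\<^sub>m M)"
    by (simp add: Suc)
  also have "\<dots> = c \<cdot>\<^sub>m ((c ^ k \<cdot>\<^sub>m M ^\<^sub>m k) * M)"
    by (rule mult_smult_distrib[of _ N N _ N]) (use assms Mk in auto)
  also have "(c ^ k \<cdot>\<^sub>m M ^\<^sub>m k) * M = c ^ k \<cdot>\<^sub>m (M ^\<^sub>m k * M)"
    by (rule mult_smult_assoc_mat[of _ N N _ N]) (use assms Mk in auto)
  finally show ?case
    by (auto simp: mult_ac)
qed (use assms in auto)

text \<open>An eigenvector for an eigenvalue of maximal modulus is also one for the n-th power.
  Reading the eigenvector equation in the coordinate of largest modulus \<open>X\<close> bounds the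
  eigenvalue by a row sum.\<close>

lemma spectral_radius_power_le:
  fixes M :: "complex Matrix.mat"
  assumes M: "M \<in> carrier_mat N N" and N: "0 < N"
    and bound: "\<And>i j. i < N \<Longrightarrow> j < N \<Longrightarrow> cmod ((M ^\<^sub>m n) $$ (i, j)) \<le> c"
  shows "spectral_radius M ^ n \<le> N * c"
proof -
  obtain k x where k: "spectral_radius M = cmod k" "eigenvector M x k"
    using spectral_radius_mem_max(1)[OF M N] by (auto simp: spectrum_def eigenvalue_def)
  then have x: "x \<in> carrier_vec N" "x \<noteq> 0\<^sub>v N"
    using M by (auto simp: eigenvector_def)
  have Mx: "M ^\<^sub>m n *\<^sub>v x = k ^ n \<cdot>\<^sub>v x"
    by (rule eigenvector_pow[OF M k(2)])
  define X where "X = Max ((\<lambda>i. cmod (vec_index x i)) ` {..<N})"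
  have le: "cmod (vec_index x i) \<le> X" if "i < N" for i
    unfolding X_def using that by (intro Max_ge) auto
  have "X \<in> (\<lambda>i. cmod (vec_index x i)) ` {..<N}"
    unfolding X_def using N by (intro Max_in) auto
  then obtain i where i: "i < N" "X = cmod (vec_index x i)"
    by auto
  obtain j where "j < N" "vec_index x j \<noteq> 0"
    using x by (auto simp: Matrix.vec_eq_iff)
  then have "0 < X"
    using le[of j] by (auto intro: less_le_trans[of 0 "cmod (vec_index x j)"])
  have "cmod k ^ n * X = cmod (vec_index (M ^\<^sub>m n *\<^sub>v x) i)"
    using i x(1) by (simp add: Mx norm_mult norm_power)
  also have "vec_index (M ^\<^sub>m n *\<^sub>v x) i = (\<Sum>j<N. (M ^\<^sub>m n) $$ (i, j) * vec_index x j)"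
    using i x(1) M by (simp add: mult_mat_vec_def scalar_prod_def atLeast0LessThan)
  also have "cmod \<dots> \<le> (\<Sum>j<N. c * X)"
    using i le bound
    by (intro sum_norm_le) (auto simp: norm_mult intro!: mult_mono intro: order_trans[OF norm_ge_zero])
  finally show ?thesis
    using \<open>0 < X\<close> by (simp add: k(1))
qed

text \<open>Dividing by \<open>s\<close> moves the spectral radius below 1, where the Jordan normal
  form bounds all powers at once. At \<open>s\<close> equal to the spectral radius, nontrivial
  Jordan blocks could add polynomial growth, hence the strict inequality.\<close>

lemma power_entries_bounded:
  fixes M :: "complex Matrix.mat"
  assumes M: "M \<in> carrier_mat N N" and N: "0 < N" and s: "spectral_radius M < s"
  obtains C where "\<And>n i j. i < N \<Longrightarrow> j < N \<Longrightarrow> cmod ((M ^\<^sub>m n) $$ (i, j)) \<le> C * s ^ n"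
proof -
  have "0 \<le> spectral_radius M"
    using spectral_radius_mem_max(1)[OF M N] by auto
  with s have s0: "0 < s" by simp
  define T where "T = complex_of_real (1 / s) \<cdot>\<^sub>m M"
  have T: "T \<in> carrier_mat N N"
    using M by (simp add: T_def)
  have "cmod k < 1" if "k \<in> spectrum T" for k
  proof -
    obtain x where x: "x \<in> carrier_vec N" "x \<noteq> 0\<^sub>v N" "T *\<^sub>v x = k \<cdot>\<^sub>v x"
      using \<open>k \<in> spectrum T\<close> T by (auto simp: spectrum_def eigenvalue_def eigenvector_def)
    have "M = complex_of_real s \<cdot>\<^sub>m T"
      using s0 M by (auto simp: T_def)
    then have "M *\<^sub>v x = (s * k) \<cdot>\<^sub>v x"
      using x T by (auto simp: Matrix.vec_eq_iff scalar_prod_def mult.assoc sum_distrib_left[symmetric])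
    then have "s * k \<in> spectrum M"
      using x M by (auto simp: spectrum_def eigenvalue_def eigenvector_def)
    then have "cmod (s * k) \<le> spectral_radius M"
      using spectral_radius_mem_max(2)[OF M N] by blast
    then have "s * cmod k \<le> spectral_radius M"
      using s0 by (simp add: norm_mult)
    also have "\<dots> < s * 1"
      using s by simp
    finally show ?thesis
      using s0 by (simp only: mult_less_cancel_left_pos)
  qed
  then have "spectral_radius T < 1"
    using spectral_radius_mem_max(1)[OF T N] by auto
  then obtain C where C: "\<And>n. norm_bound (T ^\<^sub>m n) C"
    using spectral_radius_jnf_norm_bound_less_1_upper_triangular[OF T] by auto
  show ?thesis
  proof (rule that)
    fix n i j assume ij: "i < N" "j < N"
    then have "cmod ((T ^\<^sub>m n) $$ (i, j)) \<le> C"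
      using C[of n] T by (auto simp: norm_bound_def)
    moreover have "(T ^\<^sub>m n) $$ (i, j) = complex_of_real (1 / s) ^ n * (M ^\<^sub>m n) $$ (i, j)"
      unfolding T_def pow_smult_mat[OF M] using ij M by simp
    ultimately show "cmod ((M ^\<^sub>m n) $$ (i, j)) \<le> C * s ^ n"
      using s0 by (simp add: norm_mult norm_power norm_divide power_divide field_simps)
  qed
qed

section \<open>Lebesgue measure of linear images\<close>

no_notation Matrix.vec_index (infixl "$" 100)
hide_const (open) Matrix.mat Matrix.row Determinant.det Polynomial.content Order.top
hide_type (open) Matrix.vec

lemma measure_shear:
  fixes S :: "(real^'n) set" and m n :: 'n
  assumes "m \<noteq> n" "S \<in> lmeasurable"
  defines "h \<equiv> \<lambda>x::real^'n. \<chi> i. if i = m then x$m + x$n else x$i"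
  shows "h ` S \<in> lmeasurable \<and> measure lebesgue (h ` S) = measure lebesgue S"
proof -
  have lin: "linear h"
    by (rule linearI) (auto simp: h_def Finite_Cartesian_Product.vec_eq_iff algebra_simps)
  have "measure lebesgue (h ` cbox a b) = measure lebesgue (cbox a b)" for a b
  proof (cases "cbox a b = {}")
    case False
    \<comment> \<open>The box formula \<open>measure_shear_interval\<close> asks for a nonnegative
      lower bound in coordinate \<open>n\<close>; translating by \<open>-t\<close> makes that bound
      0.\<close>
    define t where "t = axis n (a$n)"
    have "h ` (+) (-t) ` cbox a b = (+) (h (-t)) ` h ` cbox a b"
      unfolding image_image linear_add[OF lin] ..
    moreover have "measure lebesgue (h ` (+) (-t) ` cbox a b) = measure lebesgue ((+) (-t) ` cbox a b)"
      unfolding cbox_translation[symmetric] h_def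
      by (rule measure_shear_interval) (use assms False in \<open>auto simp: t_def interval_eq_empty_cart\<close>)
    ultimately show ?thesis
      by (metis measure_translation)
  qed simp
  then show ?thesis
    using measure_linear_sufficient[OF lin assms(2), of 1] by simp
qed

lemma measure_swap_coordinates:
  fixes S :: "(real^'n) set" and m n :: 'n
  assumes "S \<in> lmeasurable"
  defines "h \<equiv> \<lambda>x::real^'n. \<chi> i. x $ Transposition.transpose m n i"
  shows "h ` S \<in> lmeasurable \<and> measure lebesgue (h ` S) = measure lebesgue S"
proof -
  have lin: "linear h"
    by (rule linearI) (auto simp: h_def Finite_Cartesian_Product.vec_eq_iff)
  have hh: "h (h x) = x" for x
    by (simp add: h_def Finite_Cartesian_Product.vec_eq_iff)
  have "measure lebesgue (h ` cbox a b) = measure lebesgue (cbox a b)" for a b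
  proof (cases "cbox a b = {}")
    case False
    have mem: "h x \<in> cbox (h a) (h b)" if "x \<in> cbox a b" for x a b
      using that by (auto simp: h_def mem_box_cart)
    have eq: "h ` cbox a b = cbox (h a) (h b)"
    proof (intro equalityI subsetI)
      fix y assume "y \<in> cbox (h a) (h b)"
      then show "y \<in> h ` cbox a b"
        using mem[of y "h a" "h b"] hh by (metis image_eqI)
    qed (use mem in blast)
    moreover have "cbox (h a) (h b) \<noteq> {}"
      using False eq by blast
    ultimately show ?thesis
      using False prod.permute[OF permutes_swap_id, where S=UNIV and g="\<lambda>i. (b - a)$i"]
      by (simp add: content_cbox_cart h_def o_def)
  qed simp
  then show ?thesis
    using measure_linear_sufficient[OF lin assms(1), of 1] by simp
qed

lemma det_shear:
  assumes "m \<noteq> n"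
  shows "det (matrix (\<lambda>x::real^'n. \<chi> i. if i = m then x$m + x$n else x$i)) = 1"
proof -
  have "matrix (\<lambda>x::real^'n. \<chi> i. if i = m then x$m + x$n else x$i)
      = (\<chi> k. if k = m then row m (mat 1) + 1 *s row n (mat 1) else row k (mat 1))"
    by (auto simp: matrix_def Finite_Cartesian_Product.row_def Finite_Cartesian_Product.mat_def axis_def Finite_Cartesian_Product.vec_eq_iff)
  then show ?thesis
    using det_row_operation[OF assms, of "mat 1" 1] by simp
qed

text \<open>A swap is an involution, so its determinant squares to 1. This also covers
  \<open>m = n\<close>, where the map is the identity.\<close>

lemma det_swap_coordinates:
  "\<bar>det (matrix (\<lambda>x::real^'n. \<chi> i. x $ Transposition.transpose m n i))\<bar> = 1"
proof -
  let ?h = "\<lambda>x::real^'n. \<chi> i. x $ Transposition.transpose m n i"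
  have lin: "linear ?h"
    by (rule linearI) (auto simp: Finite_Cartesian_Product.vec_eq_iff)
  have "det (matrix ?h) * det (matrix ?h) = det (matrix (?h \<circ> ?h))"
    by (simp add: det_mul matrix_compose[OF lin lin])
  also have "?h \<circ> ?h = id"
    by (auto simp: Finite_Cartesian_Product.vec_eq_iff)
  finally have "(det (matrix ?h))\<^sup>2 = 1"
    unfolding matrix_id_mat_1 power2_eq_square by simp
  then show ?thesis
    by (auto simp: power2_eq_1_iff)
qed

text \<open>The library version \<^term>\<open>measure_linear_image\<close> needs a well-ordered index type.\<close>

lemma measure_linear_image_finite:
  fixes f :: "real^'n \<Rightarrow> real^'n"
  assumes "linear f" "S \<in> lmeasurable"
  shows "f ` S \<in> lmeasurable \<and> measure lebesgue (f ` S) = \<bar>det (matrix f)\<bar> * measure lebesgue S"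
proof -
  have "\<forall>S\<in>lmeasurable. f ` S \<in> lmeasurable \<and>
      measure lebesgue (f ` S) = \<bar>det (matrix f)\<bar> * measure lebesgue S"
    (is "?P f")
  proof (rule induct_linear_elementary[where P = ?P, OF assms(1)])
    fix f g :: "real^'n \<Rightarrow> real^'n"
    assume "linear f" "linear g" "?P f" "?P g"
    then show "?P (f \<circ> g)"
      by (simp only: image_comp[symmetric] matrix_compose det_mul abs_mult) simp
  next
    fix f :: "real^'n \<Rightarrow> real^'n" and i
    assume f: "linear f" "\<And>x. f x $ i = 0"
    \<comment> \<open>A map into a coordinate hyperplane is singular: its determinant is 0 and all
      its images are negligible, so both sides vanish.\<close>
    have "f x \<noteq> axis i 1" for x
      using f(2)[of x] by (metis axis_index_axis zero_neq_one axis_nth)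
    then have "\<not> inj f"
      using linear_injective_imp_surjective[OF f(1)] by (metis surjE)
    then have "det (matrix f) = 0" "negligible (f ` S)" for S
      using det_nz_iff_inj[OF f(1)] negligible_linear_singular_image[OF f(1)] by auto
    then show "?P f"
      by (simp add: negligible_iff_measure)
  next
    fix c :: "'n \<Rightarrow> real"
    have "det (matrix (\<lambda>x. \<chi> i. c i * x$i)) = prod c UNIV"
      by (simp add: matrix_def axis_def det_diagonal)
    then show "?P (\<lambda>x. \<chi> i. c i * x$i)"
      by (simp add: measurable_stretch measure_stretch)
  qed (simp_all add: measure_shear measure_swap_coordinates det_shear det_swap_coordinates)
  then show ?thesis using assms(2) by blast
qed

section \<open>Unit cubes\<close>

lemma int_vec_simps [simp]:
  "int_vec 0"
  "int_vec x \<Longrightarrow> int_vec y \<Longrightarrow> int_vec (x + y)"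
  "int_vec x \<Longrightarrow> int_vec y \<Longrightarrow> int_vec (x - y)"
  "int_vec x \<Longrightarrow> int_vec (- x)"
  by (simp_all add: int_vec_def)

lemma int_vec_matrix_vector_mult:
  assumes "\<forall>i. int_vec (B $ i)" "int_vec x"
  shows "int_vec (B *v x)"
  using assms by (auto simp: int_vec_def matrix_vector_mult_def intro!: Ints_sum Ints_mult)

lemma countable_int_vec: "countable (Collect (int_vec :: real^'n \<Rightarrow> bool))"
proof -
  have "inj_on (\<lambda>x::real^'n. \<lambda>i. x $ i) (Collect int_vec)"
    by (auto simp: inj_on_def Finite_Cartesian_Product.vec_eq_iff fun_eq_iff)
  moreover have "countable ((\<lambda>x::real^'n. \<lambda>i. x $ i) ` Collect int_vec)"
    by (rule countable_subset[OF _ countable_PiE[of UNIV "\<lambda>_. \<int>"]])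
       (auto simp: int_vec_def Ints_def)
  ultimately show ?thesis
    by (metis countable_image_inj_on)
qed

text \<open>Indexing the cubes by their corners turns sums over cubes into sums over integer
  vectors, where convolution makes sense.\<close>

definition unit_cube :: "real^'n \<Rightarrow> (real^'n) set" where
  "unit_cube z = {x. \<forall>i. z $ i \<le> x $ i \<and> x $ i < z $ i + 1}"

lemma unit_cubes_eq: "unit_cubes = unit_cube ` Collect int_vec"
  by (auto simp: unit_cubes_def unit_cube_def)

lemma translate_vimage_unit_cube: "(\<lambda>x. x + t) -` unit_cube z = unit_cube (z - t)"
  by (auto simp: unit_cube_def algebra_simps)

lemma unit_cube_exists: "\<exists>z. int_vec z \<and> x \<in> unit_cube z"
  by (rule exI[of _ "\<chi> i. of_int \<lfloor>x $ i\<rfloor>"]) (auto simp: int_vec_def unit_cube_def)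

lemma unit_cube_unique:
  assumes "int_vec z" "int_vec w" "x \<in> unit_cube z" "x \<in> unit_cube w"
  shows "z = w"
proof -
  have "z $ i = w $ i" for i
  proof -
    have "z $ i \<in> \<int>" "w $ i \<in> \<int>"
      using assms(1,2) by (auto simp: int_vec_def)
    then obtain k l where kl: "z $ i = of_int k" "w $ i = of_int l"
      by (auto elim!: Ints_cases)
    have "z $ i \<le> x $ i" "x $ i < z $ i + 1" "w $ i \<le> x $ i" "x $ i < w $ i + 1"
      using assms(3,4) by (auto simp: unit_cube_def)
    then have "k < l + 1" "l < k + 1"
      using kl by linarith+
    then show ?thesis
      using kl by simp
  qed
  then show ?thesis
    by (simp add: Finite_Cartesian_Product.vec_eq_iff)
qed

lemma disjoint_unit_cubes: "disjoint_family_on unit_cube (Collect int_vec)"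
  unfolding disjoint_family_on_def using unit_cube_unique by blast

lemma self_in_unit_cube: "z \<in> unit_cube z"
  by (simp add: unit_cube_def)

lemma inj_on_unit_cube: "inj_on unit_cube (Collect int_vec)"
  using unit_cube_unique self_in_unit_cube by (metis inj_onI mem_Collect_eq)

lemma sets_unit_cube [measurable]: "unit_cube z \<in> sets borel"
proof -
  have "unit_cube z = (\<Inter>i. {x. z $ i \<le> x $ i} \<inter> {x. x $ i < z $ i + 1})"
    by (auto simp: unit_cube_def)
  moreover have "{x. z $ i \<le> x $ i} \<inter> {x. x $ i < z $ i + 1} \<in> sets borel" for i
    by (intro sets.Int borel_closed borel_open closed_Collect_le open_Collect_less continuous_intros)
  ultimately show ?thesis
    by (simp add: sets.countable_INT)
qed

lemma unit_cube_subset_cbox: "unit_cube z \<subseteq> cbox z (z + 1)"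
  by (auto simp: unit_cube_def mem_box_cart less_imp_le)

lemma box_subset_unit_cube: "box z (z + 1) \<subseteq> unit_cube z"
  by (auto simp: unit_cube_def mem_box_cart less_imp_le)

lemma lmeasurable_borel_bounded: "bounded E \<Longrightarrow> E \<in> sets borel \<Longrightarrow> E \<in> lmeasurable"
  by (simp add: bounded_set_imp_lmeasurable)

lemma lmeasurable_subset_unit_cube: "E \<in> sets borel \<Longrightarrow> E \<subseteq> unit_cube z \<Longrightarrow> E \<in> lmeasurable"
  by (meson bounded_cbox bounded_subset lmeasurable_borel_bounded unit_cube_subset_cbox)

lemma lmeasurable_unit_cube [simp]: "unit_cube z \<in> lmeasurable"
  by (rule lmeasurable_subset_unit_cube[OF sets_unit_cube order_refl])

text \<open>The half-open cube lies between an open and a closed box of the same volume.\<close>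

lemma measure_unit_cube: "measure lebesgue (unit_cube (z :: real^'n)) = 1"
proof -
  have 1: "content (cbox z (z + 1)) = 1"
    by (simp add: content_cbox_cart mem_box_cart interval_eq_empty_cart not_less)
  then have "content (box z (z + 1)) = 1"
    by (simp add: measure_lborel_box_eq measure_lborel_cbox_eq)
  moreover have "measure lebesgue (box z (z + 1)) \<le> measure lebesgue (unit_cube z)"
    "measure lebesgue (unit_cube z) \<le> measure lebesgue (cbox z (z + 1))"
    by (intro measure_mono_fmeasurable box_subset_unit_cube unit_cube_subset_cbox
        lmeasurable_cbox fmeasurableD[OF lmeasurable_subset_unit_cube[of _ z]]
        fmeasurableD[OF lmeasurable_box]
        lmeasurable_subset_unit_cube[of _ z] sets_unit_cube order_refl)+
  ultimately show ?thesis
    using 1 by (simp add: measure_completion)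
qed

text \<open>The l1 norm gives this crude constant; only its independence of \<open>z\<close> matters
  later.\<close>

lemma norm_diff_unit_cube:
  fixes x :: "real^'n"
  assumes "x \<in> unit_cube z" "y \<in> unit_cube z"
  shows "norm (x - y) \<le> CARD('n)"
proof -
  have "norm (x - y) \<le> (\<Sum>i\<in>UNIV. \<bar>(x - y) $ i\<bar>)"
    by (rule norm_le_l1_cart)
  also have "\<dots> \<le> (\<Sum>i\<in>(UNIV::'n set). 1)"
  proof (rule sum_mono)
    fix i
    show "\<bar>(x - y) $ i\<bar> \<le> 1"
      using assms unfolding unit_cube_def by (auto simp: abs_le_iff dest!: spec[of _ i])
  qed
  finally show ?thesis by simp
qed

section \<open>Iterates of the linear map and of its inverse\<close>

lemma linear_funpow:
  fixes f :: "'a::real_vector \<Rightarrow> 'a"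
  assumes "linear f"
  shows "linear (f ^^ n)"
  by (induction n) (simp_all only: funpow.simps linear_id linear_compose[OF _ assms])

lemma funpow_matrix_0 [simp]: "((*v) (A :: real^'n^'n) ^^ n) 0 = 0"
  by (intro linear_0 linear_funpow matrix_vector_mul_linear)

lemma matrix_inv_vector_mult:
  fixes A :: "real^'n^'n"
  assumes "invertible A"
  shows "matrix_inv A *v (A *v x) = x" "A *v (matrix_inv A *v x) = x"
proof -
  obtain C where "A ** C = mat 1 \<and> C ** A = mat 1"
    using assms by (auto simp: invertible_def)
  then have "A ** matrix_inv A = mat 1 \<and> matrix_inv A ** A = mat 1"
    unfolding matrix_inv_def by (rule someI)
  then show "matrix_inv A *v (A *v x) = x" "A *v (matrix_inv A *v x) = x"
    by (simp_all add: matrix_vector_mul_assoc)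
qed

lemma funpow_matrix_inv:
  fixes A :: "real^'n^'n"
  assumes "invertible A"
  shows "((*v) (matrix_inv A) ^^ n) (((*v) A ^^ n) x) = x"
    and "((*v) A ^^ n) (((*v) (matrix_inv A) ^^ n) x) = x"
proof (induction n arbitrary: x)
  case (Suc n)
  { case 1 show ?case
      by (subst funpow_Suc_right) (simp add: matrix_inv_vector_mult[OF assms] Suc.IH)
  next
    case 2 show ?case
      by (subst funpow_Suc_right) (simp add: matrix_inv_vector_mult[OF assms] Suc.IH) }
qed simp_all

lemma funpow_matrix_image:
  fixes A :: "real^'n^'n"
  assumes "invertible A"
  shows "((*v) A ^^ n) ` E = ((*v) (matrix_inv A) ^^ n) -` E"
  using funpow_matrix_inv[OF assms] by (auto simp: image_iff) metis

lemma continuous_on_funpow_matrix: "continuous_on S ((*v) (A :: real^'n^'n) ^^ n)"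
  by (intro linear_continuous_on linear_linear[THEN iffD2] linear_funpow matrix_vector_mul_linear)

lemma sets_funpow_matrix_image:
  fixes A :: "real^'n^'n"
  assumes "invertible A" "E \<in> sets borel"
  shows "((*v) A ^^ n) ` E \<in> sets borel"
  unfolding funpow_matrix_image[OF assms(1)]
  using measurable_sets[OF borel_measurable_continuous_onI[OF continuous_on_funpow_matrix] assms(2)]
  by simp

lemma measure_funpow_matrix_image:
  fixes A :: "real^'n^'n"
  assumes "E \<in> lmeasurable"
  shows "((*v) A ^^ n) ` E \<in> lmeasurable \<and>
    measure lebesgue (((*v) A ^^ n) ` E) = \<bar>det A\<bar> ^ n * measure lebesgue E"
proof (induction n)
  case (Suc n)
  moreover have "((*v) A ^^ Suc n) ` E = (*v) A ` ((*v) A ^^ n) ` E"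
    by (simp add: image_comp)
  ultimately show ?case
    using measure_linear_image_finite[of "(*v) A" "((*v) A ^^ n) ` E"] by simp
qed (use assms in simp)

lemma norm_funpow_matrix:
  fixes A :: "real^'n^'n"
  shows "norm (((*v) A ^^ n) x) \<le> onorm ((*v) A) ^ n * norm x"
proof (induction n)
  case (Suc n)
  have "norm (A *v ((*v) A ^^ n) x) \<le> onorm ((*v) A) * norm (((*v) A ^^ n) x)"
    by (rule onorm) simp
  also have "\<dots> \<le> onorm ((*v) A) * (onorm ((*v) A) ^ n * norm x)"
    by (intro mult_left_mono Suc onorm_pos_le) simp
  finally show ?case by (simp add: mult_ac)
qed simp

section \<open>The law of the endpoints\<close>

locale integral_IFS_measure =
  fixes A :: "real^'n^'n" and a :: "nat \<Rightarrow> real^'n" and m :: nat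
    and p :: "nat \<Rightarrow> real" and \<mu> :: "(real^'n) measure"
  assumes IFS: "integral_affine_IFS A a m"
    and contracting: "onorm ((*v) A) < 1"
    and p_pos: "\<forall>l\<in>{1..m}. 0 < p l"
    and p_sum: "(\<Sum>l=1..m. p l) = 1"
    and self_affine: "self_affine_measure A a m p \<mu>"
begin

abbreviation "B \<equiv> matrix_inv A"
abbreviation "iter n \<equiv> (*v) A ^^ n"

sublocale prob_space \<mu>
  using self_affine by (simp add: self_affine_measure_def)

lemma sets_mu [simp, measurable_cong]: "sets \<mu> = sets borel"
  using self_affine by (simp add: self_affine_measure_def)

lemma space_mu [simp]: "space \<mu> = UNIV"
  using sets_eq_imp_space_eq[OF sets_mu] by simp

lemma invertible_A: "invertible A"
  using IFS by (simp add: integral_affine_IFS_def)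

lemma int_vec_B: "int_vec x \<Longrightarrow> int_vec (B *v x)"
  using IFS by (auto simp: integral_affine_IFS_def intro: int_vec_matrix_vector_mult)

lemma int_vec_a: "l \<in> {1..m} \<Longrightarrow> int_vec (a l)"
  using IFS by (simp add: integral_affine_IFS_def)

lemma inj_iter: "inj (iter n)"
  by (rule inj_on_inverseI[of _ "(*v) B ^^ n"]) (simp add: funpow_matrix_inv[OF invertible_A])

lemma sets_iter [measurable]: "E \<in> sets borel \<Longrightarrow> iter n ` E \<in> sets borel"
  by (rule sets_funpow_matrix_image[OF invertible_A])

lemma disjoint_iter_cubes: "disjoint_family_on (\<lambda>z. iter n ` unit_cube z) (Collect int_vec)"
  using disjoint_unit_cubes unfolding disjoint_family_on_def
  by (metis image_Int[OF inj_iter] image_empty)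

lemma sum_measure_iter_cubes_le_1:
  assumes "finite F" "F \<subseteq> Collect int_vec"
  shows "(\<Sum>z\<in>F. measure \<mu> (iter n ` unit_cube z)) \<le> 1"
proof -
  have "(\<Sum>z\<in>F. measure \<mu> (iter n ` unit_cube z)) = measure \<mu> (\<Union>z\<in>F. iter n ` unit_cube z)"
    by (intro finite_measure_finite_Union[symmetric] assms(1) image_subsetI
        disjoint_family_on_mono[OF assms(2) disjoint_iter_cubes]) simp
  then show ?thesis by simp
qed

text \<open>For a word l1 ... ln this is the sum of the vectors B^k a_(lk), that is A^(-n)
  \<phi>_(ln)(... \<phi>_(l1)(0)): the head of the list is the map applied first to 0. Prepending a
  letter is one more step x -> B(x + a_l), the kind of step that the edges of the matrix
  encode.\<close>

primrec endpoint :: "nat list \<Rightarrow> real^'n" where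
  "endpoint [] = 0"
| "endpoint (l # w) = B *v (endpoint w + a l)"

primrec weight :: "nat list \<Rightarrow> real" where
  "weight [] = 1"
| "weight (l # w) = p l * weight w"

definition words :: "nat \<Rightarrow> nat list set" where
  "words n = {w. set w \<subseteq> {1..m} \<and> length w = n}"

lemma finite_words [simp]: "finite (words n)"
  unfolding words_def by (rule finite_lists_length_eq) simp

lemma words_0 [simp]: "words 0 = {[]}"
  by (auto simp: words_def)

lemma sum_words_Suc:
  "(\<Sum>w\<in>words (Suc n). f w) = (\<Sum>l=1..m. \<Sum>w\<in>words n. f (l # w))"
proof -
  have "words (Suc n) = (\<lambda>(l, w). l # w) ` ({1..m} \<times> words n)"
    by (auto simp: words_def length_Suc_conv image_iff)
  moreover have "inj_on (\<lambda>(l, w). l # w) ({1..m} \<times> words n)"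
    by (auto simp: inj_on_def)
  ultimately show ?thesis
    by (simp add: sum.reindex sum.cartesian_product case_prod_unfold)
qed

lemma weight_nonneg: "w \<in> words n \<Longrightarrow> 0 \<le> weight w"
proof (induction w arbitrary: n)
  case (Cons l w)
  then have "w \<in> words (length w)" "0 \<le> p l"
    using p_pos by (auto simp: words_def intro: less_imp_le)
  then show ?case
    using Cons.IH by simp
qed simp

lemma sum_weight: "(\<Sum>w\<in>words n. weight w) = 1"
  using p_sum by (induction n) (simp_all add: sum_words_Suc sum_distrib_left[symmetric])

lemma int_vec_endpoint: "w \<in> words n \<Longrightarrow> int_vec (endpoint w)"
proof (induction w arbitrary: n)
  case (Cons l w)
  then have "int_vec (endpoint w)" "int_vec (a l)"
    by (auto intro: int_vec_a Cons.IH[of "length w"] simp: words_def)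
  then show ?case
    by (simp add: int_vec_B)
qed simp

text \<open>Since \<phi>_l(x) + t = A(x + B(t + a_l)), the preimage of a translate of A E under
  \<phi>_l is a translate of E. Iterating self-affinity therefore writes the measure of A^n E as an
  average over translates of E, weighted by the law of the endpoint.\<close>

lemma measure_iter_image:
  assumes "E \<in> sets borel"
  shows "measure \<mu> (iter n ` E) = (\<Sum>w\<in>words n. weight w * measure \<mu> ((\<lambda>x. x + endpoint w) -` E))"
  using assms
proof (induction n arbitrary: E)
  case (Suc n)
  have step: "measure \<mu> ((\<lambda>x. x + t) -` ((*v) A ` E))
      = (\<Sum>l=1..m. p l * measure \<mu> ((\<lambda>x. x + B *v (t + a l)) -` E))" for t
  proof -
    have "(\<lambda>x. x + t) -` ((*v) A ` E) \<in> sets borel"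
      using measurable_sets[of "\<lambda>x. x + t" borel borel "(*v) A ` E"] sets_iter[OF Suc.prems, of 1]
      by simp
    moreover have "ifs_map A a l -` (\<lambda>x. x + t) -` ((*v) A ` E) = (\<lambda>x. x + B *v (t + a l)) -` E" for l
    proof -
      have "A *v x + a l + t = A *v (x + B *v (t + a l))" for x
        by (simp add: matrix_vector_right_distrib matrix_inv_vector_mult[OF invertible_A])
      moreover have "A *v x \<in> (*v) A ` E \<longleftrightarrow> x \<in> E" for x
        using inj_image_mem_iff[OF inj_iter[of 1]] by simp
      ultimately show ?thesis
        by (auto simp: ifs_map_def vimage_def)
    qed
    ultimately show ?thesis
      using self_affine by (simp add: self_affine_measure_def)
  qed
  \<comment> \<open>The factor \<open>A\<close> next to \<open>E\<close> is split off: the induction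
    hypothesis produces translates of A E, and \<open>step\<close> resolves each of them, the new
    letter becoming the head of the word.\<close>
  have "iter (Suc n) ` E = iter n ` ((*v) A ` E)"
    by (simp only: funpow_Suc_right image_comp)
  then have "measure \<mu> (iter (Suc n) ` E)
      = (\<Sum>w\<in>words n. \<Sum>l=1..m. weight w * (p l * measure \<mu> ((\<lambda>x. x + B *v (endpoint w + a l)) -` E)))"
    using Suc.IH[of "(*v) A ` E"] sets_iter[OF Suc.prems, of 1] by (simp add: step sum_distrib_left)
  also have "\<dots> = (\<Sum>w\<in>words (Suc n). weight w * measure \<mu> ((\<lambda>x. x + endpoint w) -` E))"
    by (subst sum.swap) (simp add: sum_words_Suc mult_ac)
  finally show ?case .
qed simp

section \<open>The law of the endpoints and its autocorrelation\<close>

definition endpoints :: "nat \<Rightarrow> (real^'n) set" where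
  "endpoints n = endpoint ` words n"

text \<open>This is P n. Words with a common endpoint are collected, so exact overlaps of the IFS
  are accounted for.\<close>

definition mass :: "nat \<Rightarrow> real^'n \<Rightarrow> real" where
  "mass n x = (\<Sum>w\<in>words n. if endpoint w = x then weight w else 0)"

text \<open>The law of the difference of the endpoints of two independent words, which is the
  autocorrelation of \<open>mass n\<close>. The form over pairs of words is the one that appears in
  powers of the transition matrix.\<close>

definition pair_mass :: "nat \<Rightarrow> real^'n \<Rightarrow> real" where
  "pair_mass n y = (\<Sum>w\<in>words n. \<Sum>w'\<in>words n.
     if endpoint w - endpoint w' = y then weight w * weight w' else 0)"

lemma finite_endpoints [simp]: "finite (endpoints n)"
  by (simp add: endpoints_def)

lemma endpoints_int_vec: "x \<in> endpoints n \<Longrightarrow> int_vec x"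
  by (auto simp: endpoints_def int_vec_endpoint)

lemma mass_nonneg: "0 \<le> mass n x"
  by (auto simp: mass_def intro!: sum_nonneg weight_nonneg)

lemma mass_eq_0: "x \<notin> endpoints n \<Longrightarrow> mass n x = 0"
  by (auto simp: mass_def endpoints_def intro!: sum.neutral)

lemma sum_words_eq_sum_endpoints:
  "(\<Sum>w\<in>words n. weight w * f (endpoint w)) = (\<Sum>x\<in>endpoints n. mass n x * f x)"
proof -
  have "(\<Sum>x\<in>endpoints n. mass n x * f x)
      = (\<Sum>x\<in>endpoints n. \<Sum>w\<in>words n. if endpoint w = x then weight w * f x else 0)"
    by (auto simp: mass_def sum_distrib_right intro!: sum.cong)
  also have "\<dots> = (\<Sum>w\<in>words n. \<Sum>x\<in>endpoints n. if endpoint w = x then weight w * f x else 0)"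
    by (rule sum.swap)
  also have "\<dots> = (\<Sum>w\<in>words n. weight w * f (endpoint w))"
    by (rule sum.cong) (auto simp: endpoints_def)
  finally show ?thesis ..
qed

lemma pair_mass_eq: "pair_mass n y = (\<Sum>x\<in>endpoints n. mass n x * mass n (x + y))"
proof -
  have "pair_mass n y = (\<Sum>w'\<in>words n. weight w' * mass n (endpoint w' + y))"
    unfolding pair_mass_def mass_def sum_distrib_left
    by (subst sum.swap) (auto intro!: sum.cong simp: algebra_simps)
  then show ?thesis
    by (simp only: sum_words_eq_sum_endpoints[where f = "\<lambda>x. mass n (x + y)"])
qed

lemma pair_mass_0: "pair_mass n 0 = (\<Sum>x\<in>endpoints n. (mass n x)\<^sup>2)"
  by (simp add: pair_mass_eq power2_eq_square)

text \<open>By 2ab \<le> a^2 + b^2 the autocorrelation is at most the mean of two square sums, of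
  \<open>mass n\<close> and of its translate by \<open>y\<close>. The second one is not larger than
  the first because \<open>mass n\<close> vanishes off the endpoints.\<close>

lemma pair_mass_le: "pair_mass n y \<le> pair_mass n 0"
proof -
  let ?T = "endpoints n"
  have "(\<Sum>x\<in>?T. (mass n (x + y))\<^sup>2) = (\<Sum>u\<in>(\<lambda>x. x + y) ` ?T. (mass n u)\<^sup>2)"
    by (simp add: sum.reindex inj_on_def)
  also have "\<dots> = (\<Sum>u\<in>(\<lambda>x. x + y) ` ?T \<inter> ?T. (mass n u)\<^sup>2)"
    by (rule sum.mono_neutral_right) (auto simp: mass_eq_0)
  also have "\<dots> \<le> (\<Sum>u\<in>?T. (mass n u)\<^sup>2)"
    by (rule sum_mono2) auto
  finally have shift: "(\<Sum>x\<in>?T. (mass n (x + y))\<^sup>2) \<le> pair_mass n 0"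
    by (simp add: pair_mass_0)
  have "2 * pair_mass n y = (\<Sum>x\<in>?T. 2 * mass n x * mass n (x + y))"
    by (simp add: pair_mass_eq sum_distrib_left mult_ac)
  also have "\<dots> \<le> (\<Sum>x\<in>?T. (mass n x)\<^sup>2 + (mass n (x + y))\<^sup>2)"
    by (intro sum_mono sum_squares_bound)
  finally show ?thesis
    using shift by (simp add: sum.distrib pair_mass_0)
qed

lemma pair_mass_nonneg: "0 \<le> pair_mass n y"
  by (auto simp: pair_mass_eq intro!: sum_nonneg mult_nonneg_nonneg mass_nonneg)

text \<open>A law of total mass 1 cannot vanish everywhere.\<close>

lemma pair_mass_pos: "0 < pair_mass n 0"
proof (rule ccontr)
  assume "\<not> ?thesis"
  then have "(\<Sum>x\<in>endpoints n. (mass n x)\<^sup>2) = 0"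
    using pair_mass_nonneg[of n 0] by (simp add: pair_mass_0)
  then have "mass n x = 0" if "x \<in> endpoints n" for x
    using that by (simp add: sum_nonneg_eq_0_iff)
  then show False
    using sum_words_eq_sum_endpoints[where f = "\<lambda>_. 1" and n = n] sum_weight by simp
qed

section \<open>Comparison of the energy with the square sum of the law\<close>

lemma measure_iter_cube:
  "measure \<mu> (iter n ` unit_cube z) = (\<Sum>x\<in>endpoints n. mass n x * measure \<mu> (unit_cube (z - x)))"
  using sum_words_eq_sum_endpoints[where f = "\<lambda>x. measure \<mu> (unit_cube (z - x))"]
  by (simp add: measure_iter_image translate_vimage_unit_cube)

lemma sum_measure_translated_cubes_le_1:
  assumes "finite F" "F \<subseteq> Collect int_vec" "inj_on g F" "\<And>z. z \<in> F \<Longrightarrow> int_vec (g z)"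
  shows "(\<Sum>z\<in>F. measure \<mu> (unit_cube (g z))) \<le> 1"
  using sum_measure_iter_cubes_le_1[of "g ` F" 0] assms by (auto simp: sum.reindex)

text \<open>Young's inequality: the l2 norm of a convolution P * g is at most the l2 norm of P times
  the l1 norm of g. Here the latter is at most 1, as g lists the probabilities of disjoint
  cubes.\<close>

lemma sum_square_iter_cubes_le:
  assumes "finite F" "F \<subseteq> Collect int_vec"
  shows "(\<Sum>z\<in>F. (measure \<mu> (iter n ` unit_cube z))\<^sup>2) \<le> pair_mass n 0"
proof -
  let ?g = "\<lambda>z. measure \<mu> (unit_cube z)" and ?T = "endpoints n"
  have "(measure \<mu> (iter n ` unit_cube z))\<^sup>2 \<le> (\<Sum>x\<in>?T. (mass n x)\<^sup>2 * ?g (z - x))"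
    if z: "z \<in> F" for z
  proof -
    \<comment> \<open>One square root of g stays with the mass and one stands alone, so that
      Cauchy-Schwarz leaves a g-weighted sum of squares times a sum of g.\<close>
    have "(measure \<mu> (iter n ` unit_cube z))\<^sup>2
        = (\<Sum>x\<in>?T. (mass n x * sqrt (?g (z - x))) * sqrt (?g (z - x)))\<^sup>2"
      by (simp add: measure_iter_cube mult.assoc)
    also have "\<dots> \<le> (\<Sum>x\<in>?T. (mass n x * sqrt (?g (z - x)))\<^sup>2) * (\<Sum>x\<in>?T. (sqrt (?g (z - x)))\<^sup>2)"
      by (rule Cauchy_Schwarz_ineq_sum)
    also have "\<dots> = (\<Sum>x\<in>?T. (mass n x)\<^sup>2 * ?g (z - x)) * (\<Sum>x\<in>?T. ?g (z - x))"
      by (simp add: power_mult_distrib)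
    also have "\<dots> \<le> (\<Sum>x\<in>?T. (mass n x)\<^sup>2 * ?g (z - x)) * 1"
      using z assms
      by (intro mult_left_mono sum_nonneg sum_measure_translated_cubes_le_1)
         (auto simp: inj_on_def endpoints_int_vec)
    finally show ?thesis by simp
  qed
  then have "(\<Sum>z\<in>F. (measure \<mu> (iter n ` unit_cube z))\<^sup>2)
      \<le> (\<Sum>z\<in>F. \<Sum>x\<in>?T. (mass n x)\<^sup>2 * ?g (z - x))"
    by (rule sum_mono)
  also have "\<dots> = (\<Sum>x\<in>?T. (mass n x)\<^sup>2 * (\<Sum>z\<in>F. ?g (z - x)))"
    by (subst sum.swap) (simp add: sum_distrib_left)
  also have "\<dots> \<le> (\<Sum>x\<in>?T. (mass n x)\<^sup>2 * 1)"
    using assms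
    by (intro sum_mono mult_left_mono sum_measure_translated_cubes_le_1)
       (auto simp: inj_on_def endpoints_int_vec subset_iff)
  finally show ?thesis
    by (simp add: pair_mass_0)
qed

text \<open>This is S n; \<open>energy_eq\<close> identifies it with the sum over
  \<open>unit_cubes\<close>.\<close>

definition energy :: "nat \<Rightarrow> real" where
  "energy n = (\<Sum>\<^sub>\<infinity>z\<in>Collect int_vec. (measure \<mu> (iter n ` unit_cube z))\<^sup>2)"

lemma energy_eq: "(\<Sum>\<^sub>\<infinity>Q\<in>unit_cubes. (measure \<mu> (iter n ` Q))\<^sup>2) = energy n"
  unfolding energy_def unit_cubes_eq by (simp add: infsum_reindex[OF inj_on_unit_cube] o_def)

text \<open>Without summability \<open>infsum\<close> would be 0 by convention; this makes the
  energy a genuine sum.\<close>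

lemma energy_summable: "(\<lambda>z. (measure \<mu> (iter n ` unit_cube z))\<^sup>2) summable_on Collect int_vec"
  by (rule nonneg_bdd_above_summable_on)
     (auto intro!: bdd_aboveI2[of _ _ "pair_mass n 0"] sum_square_iter_cubes_le)

lemma energy_le: "energy n \<le> pair_mass n 0"
  unfolding energy_def
  by (rule infsum_le_finite_sums[OF energy_summable]) (rule sum_square_iter_cubes_le)

lemma finite_sum_le_energy:
  assumes "finite F" "F \<subseteq> Collect int_vec"
  shows "(\<Sum>z\<in>F. (measure \<mu> (iter n ` unit_cube z))\<^sup>2) \<le> energy n"
  unfolding energy_def by (rule finite_sum_le_infsum[OF energy_summable assms]) simp

text \<open>In the convolution at z = y + x only the term x is kept. These z are distinct as x runs
  through the endpoints, so a single cube of positive measure bounds the energy below by a multiple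
  of the square sum.\<close>

lemma energy_ge:
  assumes "int_vec y"
  shows "(measure \<mu> (unit_cube y))\<^sup>2 * pair_mass n 0 \<le> energy n"
proof -
  let ?T = "endpoints n"
  have "(measure \<mu> (unit_cube y))\<^sup>2 * pair_mass n 0
      = (\<Sum>x\<in>?T. (mass n x * measure \<mu> (unit_cube (y + x - x)))\<^sup>2)"
    by (simp add: pair_mass_0 sum_distrib_left power_mult_distrib mult.commute)
  also have "\<dots> \<le> (\<Sum>x\<in>?T. (measure \<mu> (iter n ` unit_cube (y + x)))\<^sup>2)"
    unfolding measure_iter_cube
    by (intro sum_mono power_mono member_le_sum) (auto simp: mass_nonneg)
  also have "\<dots> = (\<Sum>z\<in>(+) y ` ?T. (measure \<mu> (iter n ` unit_cube z))\<^sup>2)"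
    by (simp add: sum.reindex)
  also have "\<dots> \<le> energy n"
    using assms by (intro finite_sum_le_energy) (auto simp: endpoints_int_vec)
  finally show ?thesis .
qed

text \<open>Countably many null cubes could not cover the space.\<close>

lemma charged_cube: "\<exists>y. int_vec y \<and> 0 < measure \<mu> (unit_cube y)"
proof (rule ccontr)
  assume *: "\<not> ?thesis"
  have "(\<Union>y\<in>Collect int_vec. unit_cube y) \<in> null_sets \<mu>"
    using * by (intro null_sets_UN' countable_int_vec)
      (auto simp: null_sets_def emeasure_eq_measure zero_less_measure_iff not_less)
  moreover have "(\<Union>y\<in>Collect int_vec. unit_cube y) = space \<mu>"
    using unit_cube_exists by auto
  ultimately show False
    using emeasure_space_1 by (simp only: null_sets_def) simp
qed

end

section \<open>Powers of the transition matrix\<close>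

locale integral_IFS_transition = integral_IFS_measure A a m p \<mu>
  for A :: "real^'n^'n" and a :: "nat \<Rightarrow> real^'n" and m :: nat
    and p :: "nat \<Rightarrow> real" and \<mu> :: "(real^'n) measure" +
  fixes R :: real and N :: nat and v :: "nat \<Rightarrow> real^'n" and M :: "real Matrix.mat"
  assumes radius: "admissible_radius A a m R"
    and v_bij: "bij_betw v {..<N} (Omega A a m R)" and v_0: "v 0 = 0"
    and M_def: "M = transition_matrix A a m p N v"
begin

lemma Lambda_0: "0 \<in> Lambda A a m"
  unfolding Lambda_def by (intro CollectI exI[of _ 0]) simp

lemma Lambda_step:
  assumes "u \<in> Lambda A a m" "i \<in> {1..m}" "j \<in> {1..m}"
  shows "B *v (u + a i - a j) \<in> Lambda A a m"
proof -
  obtain n \<epsilon> where u: "u = (\<Sum>k=1..n. ((*v) B ^^ k) (\<epsilon> k))"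
    and \<epsilon>: "\<forall>k\<in>{1..n}. \<epsilon> k \<in> difference_set a m"
    using assms(1) by (auto simp: Lambda_def)
  \<comment> \<open>Applying \<open>B\<close> moves every digit of \<open>u\<close> up by one place;
    the new digit takes place 1.\<close>
  define \<epsilon>' where "\<epsilon>' = (\<lambda>k. if k = 1 then a i - a j else \<epsilon> (k - 1))"
  have "(\<Sum>k=1..Suc n. ((*v) B ^^ k) (\<epsilon>' k))
      = B *v (a i - a j) + (\<Sum>k=Suc 1..Suc n. ((*v) B ^^ k) (\<epsilon>' k))"
    by (subst sum.atLeast_Suc_atMost) (simp_all add: \<epsilon>'_def)
  also have "(\<Sum>k=Suc 1..Suc n. ((*v) B ^^ k) (\<epsilon>' k)) = (\<Sum>k=1..n. B *v (((*v) B ^^ k) (\<epsilon> k)))"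
    unfolding sum.shift_bounds_cl_Suc_ivl by (auto intro!: sum.cong simp: \<epsilon>'_def)
  also have "\<dots> = B *v u"
    unfolding u by (rule linear_sum[OF matrix_vector_mul_linear, symmetric])
  also have "B *v (a i - a j) + B *v u = B *v (u + a i - a j)"
    by (simp add: matrix_vector_right_distrib matrix_vector_mult_diff_distrib)
  finally have "B *v (u + a i - a j) = (\<Sum>k=1..Suc n. ((*v) B ^^ k) (\<epsilon>' k))" ..
  moreover have "\<epsilon>' k \<in> difference_set a m" if "k \<in> {1..Suc n}" for k
  proof (cases "k = 1")
    case True
    then show ?thesis
      using assms(2,3) by (auto simp: \<epsilon>'_def difference_set_def)
  next
    case False
    then have "k - 1 \<in> {1..n}"
      using that by auto
    then show ?thesis
      using \<epsilon> False by (simp add: \<epsilon>'_def)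
  qed
  ultimately show ?thesis
    unfolding Lambda_def by (intro CollectI exI[of _ "Suc n"] exI[of _ \<epsilon>'] conjI ballI)
qed

text \<open>The vector is the position after \<open>n\<close> steps x -> B(x + a_i - a_j) of a walk
  from \<open>u\<close>. The digits are read from the ends of the lists, so the heads belong to the
  last step.\<close>

lemma Lambda_walk:
  assumes "u \<in> Lambda A a m" "w \<in> words n" "w' \<in> words n"
  shows "((*v) B ^^ n) u + endpoint w - endpoint w' \<in> Lambda A a m"
  using assms(2,3)
proof (induction n arbitrary: w w')
  case (Suc n)
  obtain l x l' x' where w: "w = l # x" "w' = l' # x'"
    and lx: "l \<in> {1..m}" "l' \<in> {1..m}" "x \<in> words n" "x' \<in> words n"
    using Suc.prems by (auto simp: words_def length_Suc_conv)
  have "((*v) B ^^ Suc n) u + endpoint w - endpoint w'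
      = B *v (((*v) B ^^ n) u + endpoint x - endpoint x' + a l - a l')"
    by (simp add: w matrix_vector_right_distrib matrix_vector_mult_diff_distrib)
  then show ?case
    using Lambda_step[OF Suc.IH[OF lx(3,4)] lx(1,2)] by simp
qed (use assms(1) in simp)

lemma N_pos: "0 < N"
proof -
  have "0 \<in> Omega A a m R"
    using radius Lambda_0 by (auto simp: Omega_def admissible_radius_def)
  then show ?thesis
    using v_bij by (auto simp: bij_betw_def gr0_conv_Suc)
       (metis all_not_in_conv image_empty lessThan_0 not0_implies_Suc)
qed

lemma M_carrier: "M \<in> carrier_mat N N"
  by (simp add: M_def transition_matrix_def)

lemma M_entry:
  assumes "r < N" "s < N"
  shows "M $$ (r, s) = (\<Sum>(i, j)\<in>{1..m} \<times> {1..m}.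
    if v s = B *v (v r + a i - a j) then p i * p j else 0)"
proof -
  have "edges A a m v r s = {e\<in>{1..m} \<times> {1..m}. v s = B *v (v r + a (fst e) - a (snd e))}"
    by (auto simp: edges_def)
  then have "M $$ (r, s) = (\<Sum>e\<in>{e\<in>{1..m} \<times> {1..m}. v s = B *v (v r + a (fst e) - a (snd e))}.
      p (fst e) * p (snd e))"
    using assms by (simp add: M_def transition_matrix_def case_prod_unfold)
  also have "\<dots> = (\<Sum>e\<in>{1..m} \<times> {1..m}.
      if v s = B *v (v r + a (fst e) - a (snd e)) then p (fst e) * p (snd e) else 0)"
    by (rule sum.inter_filter) simp
  finally show ?thesis
    by (simp add: case_prod_unfold)
qed

text \<open>The heads of both words form the last step of a walk; the sums are regrouped to separate
  it from the first \<open>n\<close> steps, as in the product of M^n with M.\<close>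

lemma pair_mass_Suc:
  "pair_mass (Suc n) y = (\<Sum>(w, w')\<in>words n \<times> words n. \<Sum>(i, j)\<in>{1..m} \<times> {1..m}.
     if B *v (endpoint w - endpoint w' + a i - a j) = y
     then (weight w * weight w') * (p i * p j) else 0)"
proof -
  have "pair_mass (Suc n) y = (\<Sum>i=1..m. \<Sum>w\<in>words n. \<Sum>j=1..m. \<Sum>w'\<in>words n.
      if B *v (endpoint w - endpoint w' + a i - a j) = y
      then (weight w * weight w') * (p i * p j) else 0)"
    unfolding pair_mass_def sum_words_Suc
    by (intro sum.cong refl if_cong)
       (simp_all add: matrix_vector_mult_diff_distrib[symmetric] algebra_simps)
  also have "\<dots> = (\<Sum>w\<in>words n. \<Sum>i=1..m. \<Sum>j=1..m. \<Sum>w'\<in>words n.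
      if B *v (endpoint w - endpoint w' + a i - a j) = y
      then (weight w * weight w') * (p i * p j) else 0)"
    by (rule sum.swap)
  also have "\<dots> = (\<Sum>w\<in>words n. \<Sum>i=1..m. \<Sum>w'\<in>words n. \<Sum>j=1..m.
      if B *v (endpoint w - endpoint w' + a i - a j) = y
      then (weight w * weight w') * (p i * p j) else 0)"
    by (intro sum.cong refl sum.swap)
  also have "\<dots> = (\<Sum>w\<in>words n. \<Sum>w'\<in>words n. \<Sum>i=1..m. \<Sum>j=1..m.
      if B *v (endpoint w - endpoint w' + a i - a j) = y
      then (weight w * weight w') * (p i * p j) else 0)"
    by (intro sum.cong refl sum.swap)
  finally show ?thesis
    unfolding sum.cartesian_product[symmetric] .
qed

text \<open>A walk that ends in the ball has never left it: this is where the invariance of the ball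
  under the maps \<open>x \<mapsto> A x + a i - a j\<close> enters.\<close>

lemma walk_in_Omega:
  assumes "r < N" "s < N" "w \<in> words n" "w' \<in> words n" "i \<in> {1..m}" "j \<in> {1..m}"
    and "v s = B *v (((*v) B ^^ n) (v r) + endpoint w - endpoint w' + a i - a j)"
  shows "((*v) B ^^ n) (v r) + endpoint w - endpoint w' \<in> Omega A a m R"
proof -
  let ?u = "((*v) B ^^ n) (v r) + endpoint w - endpoint w'"
  have v: "v r \<in> Omega A a m R" "v s \<in> Omega A a m R"
    using v_bij assms(1,2) by (auto simp: bij_betw_def)
  have "A *v v s = ?u + a i - a j"
    unfolding assms(7) by (rule matrix_inv_vector_mult(2)[OF invertible_A])
  then have "?u = A *v v s + (a j - a i)"
    by (simp add: algebra_simps)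
  moreover have "a j - a i \<in> difference_set a m"
    using assms by (auto simp: difference_set_def)
  ultimately have "?u \<in> cball 0 R"
    using radius v(2) by (auto simp: admissible_radius_def Omega_def image_subset_iff)
  then show ?thesis
    using v(1) Lambda_walk[OF _ assms(3,4)] by (simp add: Omega_def)
qed

text \<open>The entry adds the weights of the walks of \<open>n\<close> steps from
  \<open>v r\<close> to \<open>v s\<close>, and a pair of words leads from \<open>v r\<close> to B^n
  v_r plus the difference of its endpoints. By \<open>walk_in_Omega\<close>, restricting the states
  to the ball loses no walk that ends at a state.\<close>

lemma power_M_entry:
  assumes "r < N" "s < N"
  shows "(M ^\<^sub>m n) $$ (r, s) = pair_mass n (v s - ((*v) B ^^ n) (v r))"
  using assms(2)
proof (induction n arbitrary: s)
  case 0
  have "v s = v r \<longleftrightarrow> s = r"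
    using v_bij 0 assms(1) by (auto simp: bij_betw_def inj_on_eq_iff)
  then show ?case
    using 0 assms(1) M_carrier by (auto simp: pair_mass_def)
next
  case (Suc n)
  let ?c = "((*v) B ^^ n) (v r)" and ?P = "words n \<times> words n" and ?I = "{1..m} \<times> {1..m}"
  \<comment> \<open>\<open>F\<close> is the weight of the first \<open>n\<close> steps arriving at
    state \<open>k\<close>, \<open>G\<close> that of a last step from \<open>k\<close> to
    \<open>s\<close>, and \<open>H\<close> that of the whole walk; \<open>FGH\<close> sums out the
    intermediate state.\<close>
  define F where "F = (\<lambda>k (w, w'). if endpoint w - endpoint w' = v k - ?c
      then weight w * weight w' else 0)"
  define G where "G = (\<lambda>k (i, j). if v s = B *v (v k + a i - a j) then p i * p j else 0)"
  define H where "H = (\<lambda>(w, w') (i, j). if v s = B *v (?c + endpoint w - endpoint w' + a i - a j)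
      then (weight w * weight w') * (p i * p j) else 0)"
  have FGH: "(\<Sum>k<N. F k q * G k e) = H q e" if "q \<in> ?P" "e \<in> ?I" for q e
  proof -
    obtain w w' i j where q: "q = (w, w')" and e: "e = (i, j)"
      by (cases q, cases e)
    define u where "u = ?c + endpoint w - endpoint w'"
    have u: "endpoint w - endpoint w' = v k - ?c \<longleftrightarrow> v k = u" for k
      by (auto simp: u_def algebra_simps)
    have "(\<Sum>k<N. F k q * G k e)
        = (\<Sum>k<N. if v k = u then (if v s = B *v (u + a i - a j)
            then (weight w * weight w') * (p i * p j) else 0) else 0)"
      unfolding F_def G_def q e prod.case u by (rule sum.cong) auto
    also have "\<dots> = H q e"
    \<comment> \<open>If the walk arrives at \<open>v s\<close>, its position \<open>u\<close>
      before the last step is a state with exactly one number \<open>k\<close>; otherwise both sides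
      are 0.\<close>
    proof (cases "v s = B *v (u + a i - a j)")
      case True
      then have "u \<in> Omega A a m R"
        unfolding u_def using walk_in_Omega[OF assms(1) Suc.prems] that q e by auto
      then have "u \<in> v ` {..<N}"
        using v_bij by (simp add: bij_betw_def)
      then obtain k where k: "k < N" "v k = u"
        by auto
      then have "v l = u \<longleftrightarrow> l = k" if "l < N" for l
        using v_bij that by (auto simp: bij_betw_def inj_on_eq_iff)
      then have "(\<Sum>l<N. if v l = u then (weight w * weight w') * (p i * p j) else 0)
          = (\<Sum>l<N. if l = k then (weight w * weight w') * (p i * p j) else 0)"
        by (intro sum.cong) auto
      then show ?thesis
        using True k(1) by (simp add: H_def q e u_def)
    qed (simp add: H_def q e u_def)
    finally show ?thesis .
  qed
  have "(M ^\<^sub>m Suc n) $$ (r, s) = (\<Sum>k<N. (M ^\<^sub>m n) $$ (r, k) * M $$ (k, s))"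
    using assms(1) Suc.prems M_carrier by (simp add: scalar_prod_def atLeast0LessThan)
  also have "\<dots> = (\<Sum>k<N. (\<Sum>q\<in>?P. F k q) * (\<Sum>e\<in>?I. G k e))"
    using Suc by (intro sum.cong refl)
      (simp add: M_entry pair_mass_def sum.cartesian_product F_def G_def)
  also have "\<dots> = (\<Sum>q\<in>?P. \<Sum>e\<in>?I. \<Sum>k<N. F k q * G k e)"
    by (simp add: sum_product sum.swap[of _ _ "{..<N}"])
  also have "\<dots> = (\<Sum>q\<in>?P. \<Sum>e\<in>?I. H q e)"
    by (intro sum.cong refl FGH)
  also have "\<dots> = pair_mass (Suc n) (v s - ((*v) B ^^ Suc n) (v r))"
  proof -
    have "B *v (endpoint w - endpoint w' + a i - a j) = v s - B *v ?c
        \<longleftrightarrow> v s = B *v (?c + endpoint w - endpoint w' + a i - a j)" for w w' i j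
      by (auto simp: matrix_vector_right_distrib matrix_vector_mult_diff_distrib algebra_simps)
    then show ?thesis
      unfolding pair_mass_Suc by (simp add: H_def case_prod_unfold)
  qed
  finally show ?case .
qed

end

section \<open>The dimension formula\<close>

context integral_IFS_transition
begin

abbreviation "\<rho> \<equiv> spectral_radius (map_mat complex_of_real M)"

lemma map_M_carrier: "map_mat complex_of_real M \<in> carrier_mat N N"
  using M_carrier by simp

lemma cmod_power_entry:
  assumes "r < N" "s < N"
  shows "cmod ((map_mat complex_of_real M ^\<^sub>m n) $$ (r, s)) = pair_mass n (v s - ((*v) B ^^ n) (v r))"
proof -
  have "map_mat complex_of_real M ^\<^sub>m n = map_mat complex_of_real (M ^\<^sub>m n)"
    by (rule of_real_hom.mat_hom_pow[OF M_carrier, symmetric])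
  moreover have "M ^\<^sub>m n \<in> carrier_mat N N"
    using M_carrier by simp
  then have "r < dim_row (M ^\<^sub>m n)" "s < dim_col (M ^\<^sub>m n)"
    using assms by (simp_all only: carrier_matD)
  ultimately show ?thesis
    using assms by (simp add: power_M_entry pair_mass_nonneg)
qed

lemma power_M_entry_0: "(M ^\<^sub>m n) $$ (0, 0) = pair_mass n 0"
  using power_M_entry[OF N_pos N_pos] by (simp add: v_0)

text \<open>The entry (0, 0) dominates all others by \<open>pair_mass_le\<close>, so it alone
  controls the row sums. This takes the place of an irreducibility argument.\<close>

lemma spectral_radius_power_le_pair_mass: "\<rho> ^ n \<le> N * pair_mass n 0"
  by (rule spectral_radius_power_le[OF map_M_carrier N_pos])
     (simp add: cmod_power_entry pair_mass_le)

text \<open>Among the walks from state 0 to itself, only those that are at state 0 at time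
  \<open>j\<close> are kept.\<close>

lemma pair_mass_supermultiplicative: "pair_mass j 0 * pair_mass k 0 \<le> pair_mass (j + k) 0"
proof -
  have "pair_mass (j + k) 0 = (\<Sum>i<N. (M ^\<^sub>m j) $$ (0, i) * (M ^\<^sub>m k) $$ (i, 0))"
    using M_carrier N_pos
    by (simp add: power_M_entry_0[symmetric] pow_mat_add[OF M_carrier] scalar_prod_def atLeast0LessThan)
  moreover have "(M ^\<^sub>m j) $$ (0, 0) * (M ^\<^sub>m k) $$ (0, 0)
      \<le> (\<Sum>i<N. (M ^\<^sub>m j) $$ (0, i) * (M ^\<^sub>m k) $$ (i, 0))"
    using N_pos by (intro member_le_sum) (auto simp: power_M_entry pair_mass_nonneg)
  ultimately show ?thesis
    by (simp add: power_M_entry_0)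
qed

lemma pair_mass_power_le: "pair_mass n 0 ^ k \<le> pair_mass (k * n) 0"
proof (induction k)
  case (Suc k)
  then have "pair_mass n 0 * pair_mass n 0 ^ k \<le> pair_mass n 0 * pair_mass (k * n) 0"
    by (intro mult_left_mono pair_mass_nonneg)
  also have "\<dots> \<le> pair_mass (n + k * n) 0"
    by (rule pair_mass_supermultiplicative)
  finally show ?case by simp
qed (simp add: pair_mass_def)

text \<open>An exponential bound on a supermultiplicative sequence holds without its constant.\<close>

lemma pair_mass_le_power_of_gt:
  assumes s: "\<rho> < s"
  shows "pair_mass n 0 \<le> s ^ n"
proof (rule ccontr)
  assume *: "\<not> ?thesis"
  have "0 \<le> \<rho>"
    using spectral_radius_mem_max(1)[OF map_M_carrier N_pos] by auto
  with s have s0: "0 < s" by simp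
  obtain C where C: "\<And>n i j. i < N \<Longrightarrow> j < N \<Longrightarrow>
      cmod ((map_mat complex_of_real M ^\<^sub>m n) $$ (i, j)) \<le> C * s ^ n"
    using power_entries_bounded[OF map_M_carrier N_pos s] by blast
  have "1 < pair_mass n 0 / s ^ n"
    using * s0 by simp
  then obtain k where k: "C < (pair_mass n 0 / s ^ n) ^ k"
    using real_arch_pow by blast
  have "pair_mass n 0 ^ k \<le> C * s ^ (k * n)"
    using pair_mass_power_le[of n k] C[OF N_pos N_pos, of "k * n"]
      cmod_power_entry[OF N_pos N_pos, of "k * n"]
    by (simp add: v_0)
  then have "(pair_mass n 0 / s ^ n) ^ k \<le> C"
    using s0 by (simp add: power_divide divide_le_eq mult.commute flip: power_mult)
  with k show False by simp
qed

text \<open>The bounds for s > \<rho> carry no constant that could blow up, so s may decrease to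
  \<rho>.\<close>

lemma pair_mass_le_power: "pair_mass n 0 \<le> \<rho> ^ n"
proof (rule tendsto_lowerbound)
  show "((\<lambda>s. s ^ n) \<longlongrightarrow> \<rho> ^ n) (at_right \<rho>)"
    by (intro tendsto_intros)
  show "\<forall>\<^sub>F s in at_right \<rho>. pair_mass n 0 \<le> s ^ n"
    using eventually_at_right_less by eventually_elim (rule pair_mass_le_power_of_gt)
qed simp

lemma spectral_radius_pos: "0 < \<rho>"
  using pair_mass_pos[of 1] pair_mass_le_power[of 1] by simp

lemma energy_le_power: "energy n \<le> \<rho> ^ n"
  using energy_le pair_mass_le_power by (rule order_trans)

text \<open>The constant is the squared measure of a charged cube divided by the number of
  states.\<close>

lemma energy_ge_power: obtains c where "0 < c" "\<And>n. c * \<rho> ^ n \<le> energy n"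
proof -
  obtain y where y: "int_vec y" "0 < measure \<mu> (unit_cube y)"
    using charged_cube by blast
  have "(measure \<mu> (unit_cube y))\<^sup>2 / N * \<rho> ^ n \<le> energy n" for n
  proof -
    have "(measure \<mu> (unit_cube y))\<^sup>2 / N * \<rho> ^ n
        \<le> (measure \<mu> (unit_cube y))\<^sup>2 / N * (N * pair_mass n 0)"
      by (intro mult_left_mono spectral_radius_power_le_pair_mass) simp
    then show ?thesis
      using energy_ge[OF y(1), of n] N_pos by simp
  qed
  then show ?thesis
    using that[of "(measure \<mu> (unit_cube y))\<^sup>2 / N"] y N_pos by auto
qed

lemma L2_dimension_eq:
  "L2_dimension A \<mu> = ereal (real CARD('n) * ln \<rho> / ln \<bar>det A\<bar>)"
proof -
  obtain c where c: "0 < c" "\<And>n. c * \<rho> ^ n \<le> energy n"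
    by (rule energy_ge_power) blast
  have pos: "0 < energy n" for n
    using c(1) spectral_radius_pos by (intro less_le_trans[OF _ c(2)]) simp
  have "(\<lambda>n. ln (energy n) / n) \<longlonglongrightarrow> ln \<rho>"
  proof (rule tendsto_sandwich)
    have "(\<lambda>n. ln c * (1 / real n) + ln \<rho>) \<longlonglongrightarrow> ln c * 0 + ln \<rho>"
      by (intro tendsto_intros lim_1_over_n)
    then show "(\<lambda>n. ln c * (1 / real n) + ln \<rho>) \<longlonglongrightarrow> ln \<rho>"
      by simp
    show "\<forall>\<^sub>F n in sequentially. ln c * (1 / real n) + ln \<rho> \<le> ln (energy n) / n"
      using eventually_gt_at_top[of 0]
    proof eventually_elim
      case (elim n)
      have "ln c + n * ln \<rho> = ln (c * \<rho> ^ n)"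
        using c(1) spectral_radius_pos by (simp add: ln_mult ln_realpow)
      also have "\<dots> \<le> ln (energy n)"
        using c pos spectral_radius_pos by (subst ln_le_cancel_iff) auto
      finally have "(ln c + n * ln \<rho>) / n \<le> ln (energy n) / n"
        by (rule divide_right_mono) simp
      then show ?case
        using elim by (simp add: add_divide_distrib)
    qed
    show "\<forall>\<^sub>F n in sequentially. ln (energy n) / n \<le> ln \<rho>"
      using eventually_gt_at_top[of 0]
    proof eventually_elim
      case (elim n)
      have "ln (energy n) \<le> ln (\<rho> ^ n)"
        using pos spectral_radius_pos energy_le_power by (subst ln_le_cancel_iff) auto
      also have "\<dots> = n * ln \<rho>"
        using spectral_radius_pos by (simp add: ln_realpow)
      finally show ?case
        using elim by (simp add: field_simps)
    qed
  qed simp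
  \<comment> \<open>Convergence makes the sign of \<open>ln \<bar>det A\<bar>\<close> harmless:
    under a mere liminf, a negative factor would exchange liminf and limsup.\<close>
  then have "(\<lambda>n. ereal (real CARD('n) / ln \<bar>det A\<bar> * (ln (energy n) / n)))
      \<longlonglongrightarrow> ereal (real CARD('n) / ln \<bar>det A\<bar> * ln \<rho>)"
    by (intro tendsto_intros)
  then have "liminf (\<lambda>n. ereal (real CARD('n) / ln \<bar>det A\<bar> * (ln (energy n) / n)))
      = ereal (real CARD('n) / ln \<bar>det A\<bar> * ln \<rho>)"
    by (intro lim_imp_Liminf) simp_all
  then show ?thesis
    by (simp add: L2_dimension_def energy_eq mult.commute)
qed

end

section \<open>Absolute continuity\<close>

text \<open>A simple function below the density carries almost all the mass, and by inner regularity
  its level sets shrink to compact sets at little cost in \<mu>. So \<mu> dominates a multiple of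
  Lebesgue measure on each of finitely many disjoint compact sets, to which the covering arguments
  apply.\<close>

lemma density_compact_approx:
  fixes \<mu> :: "'a::euclidean_space measure"
  assumes "prob_space \<mu>" and sets: "sets \<mu> = sets borel"
    and ac: "absolutely_continuous lborel \<mu>" and \<epsilon>: "0 < \<epsilon>"
  obtains I :: "ennreal set" and c :: "ennreal \<Rightarrow> real" and K :: "ennreal \<Rightarrow> 'a set"
  where "finite I" "\<And>i. i \<in> I \<Longrightarrow> 0 \<le> c i" "\<And>i. i \<in> I \<Longrightarrow> compact (K i)"
    "disjoint_family_on K I"
    "\<And>i E. i \<in> I \<Longrightarrow> E \<in> sets borel \<Longrightarrow> E \<subseteq> K i \<Longrightarrow> c i * measure lborel E \<le> measure \<mu> E"
    "1 - \<epsilon> \<le> (\<Sum>i\<in>I. c i * measure lborel (K i))"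
proof -
  interpret prob_space \<mu> by fact
  have space: "space \<mu> = UNIV"
    using sets_eq_imp_space_eq[OF sets] by simp
  define f where "f = RN_deriv lborel \<mu>"
  have f: "f \<in> borel_measurable lborel"
    unfolding f_def by (rule borel_measurable_RN_deriv)
  have \<mu>: "density lborel f = \<mu>"
    unfolding f_def using sigma_finite_measure.density_RN_deriv[OF sigma_finite_lborel ac] sets by simp
  have em: "emeasure \<mu> E = (\<integral>\<^sup>+x. f x * indicator E x \<partial>lborel)" if "E \<in> sets borel" for E
    using emeasure_density[of f lborel E] f that unfolding \<mu> by simp
  have "(\<integral>\<^sup>+x. f x \<partial>lborel) = 1"
    using em[of UNIV] emeasure_space_1 space by simp
  \<comment> \<open>Half of \<epsilon> pays for the simple function, the other half for the passage
    to compact sets.\<close>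
  then have "ennreal (1 - \<epsilon> / 2) < (\<integral>\<^sup>+x. f x \<partial>lborel)"
    using \<epsilon> by (simp add: ennreal_less_one_iff)
  then obtain g where g: "simple_function lborel g" "g \<le> f" "\<And>x. g x < top"
    and int_g: "ennreal (1 - \<epsilon> / 2) < integral\<^sup>S lborel g"
    unfolding nn_integral_def_finite less_SUP_iff by blast
  \<comment> \<open>The pieces are indexed by the values of \<open>g\<close>. The value 0 is left
    out, as its level set may have infinite volume.\<close>
  define I where "I = range g - {0}"
  define U where "U i = g -` {i}" for i
  have fin: "finite I"
    using simple_functionD(1)[OF g(1)] by (simp add: I_def)
  have U: "U i \<in> sets borel" for i
    using simple_functionD(2)[OF g(1), of "{i}"] by (simp add: U_def)
  have i: "0 < i" "i < top" if "i \<in> I" for i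
    using that g(3) by (auto simp: I_def zero_less_iff_neq_zero)
  have low: "i * emeasure lborel E \<le> emeasure \<mu> E" if "E \<in> sets borel" "E \<subseteq> U i" for i E
  proof -
    have "i * emeasure lborel E = (\<integral>\<^sup>+x. i * indicator E x \<partial>lborel)"
      using that by (simp add: nn_integral_cmult_indicator)
    also have "\<dots> \<le> (\<integral>\<^sup>+x. f x * indicator E x \<partial>lborel)"
      using that g(2) by (intro nn_integral_mono) (auto simp: U_def le_fun_def split: split_indicator)
    finally show ?thesis
      using em that by simp
  qed
  have fin_U: "emeasure lborel E < top" if "E \<in> sets borel" "E \<subseteq> U i" "i \<in> I" for i E
  proof -
    have "emeasure \<mu> E < top"
      by (metis emeasure_finite less_top)
    then have "i * emeasure lborel E < top"
      using low[OF that(1,2)] by (rule le_less_trans[rotated])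
    then show ?thesis
      using i[OF that(3)] by (auto simp: ennreal_mult_less_top)
  qed
  have em_U: "emeasure lborel (U i) = ennreal (measure lborel (U i))" if "i \<in> I" for i
    using fin_U[OF U order_refl that] by (intro emeasure_eq_ennreal_measure) (simp add: less_top)
  have low': "enn2real i * measure lborel E \<le> measure \<mu> E"
    if "E \<in> sets borel" "E \<subseteq> U i" "i \<in> I" for i E
  proof -
    have "ennreal (enn2real i * measure lborel E) = i * emeasure lborel E"
      using i(2)[OF that(3)] fin_U[OF that] by (simp add: ennreal_mult emeasure_eq_ennreal_measure)
    also have "\<dots> \<le> ennreal (measure \<mu> E)"
      using low[OF that(1,2)] by (simp add: emeasure_eq_measure)
    finally show ?thesis
      by simp
  qed
  have "integral\<^sup>S lborel g = (\<Sum>i\<in>I. i * emeasure lborel (U i))"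
    unfolding simple_integral_def I_def U_def
    using simple_functionD(1)[OF g(1)] by (intro sum.mono_neutral_cong_right) auto
  also have "\<dots> = ennreal (\<Sum>i\<in>I. enn2real i * measure lborel (U i))"
    using i(2) by (subst sum_ennreal[symmetric]) (auto intro!: sum.cong simp: ennreal_mult em_U)
  finally have sum_U: "1 - \<epsilon> / 2 < (\<Sum>i\<in>I. enn2real i * measure lborel (U i))"
    using int_g by (simp add: ennreal_less_iff sum_nonneg)
       (meson ennreal_lessI ennreal_leI linorder_not_less)
  \<comment> \<open>The summand 1 keeps the denominator positive when \<open>I\<close> is
    empty.\<close>
  define \<eta> where "\<eta> = \<epsilon> / (2 * (1 + card I))"
  have \<eta>: "0 < \<eta>"
    using \<epsilon> by (simp add: \<eta>_def)
  have "\<exists>K. K \<subseteq> U i \<and> compact K \<and> measure \<mu> (U i) - \<eta> \<le> measure \<mu> K" for i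
  \<comment> \<open>A piece of small measure is replaced by the empty set; in the other case the
    difference is positive and \<open>ennreal\<close> does not truncate it.\<close>
  proof (cases "measure \<mu> (U i) \<le> \<eta>")
    case True
    then show ?thesis
      by (intro exI[of _ "{}"]) simp
  next
    case False
    then have "ennreal (measure \<mu> (U i) - \<eta>) < emeasure \<mu> (U i)"
      using \<eta> by (simp add: emeasure_eq_measure ennreal_less_iff)
    also have "\<dots> = (SUP K\<in>{K. K \<subseteq> U i \<and> compact K}. emeasure \<mu> K)"
      by (rule inner_regular) (use sets U in auto)
    finally obtain K where "K \<subseteq> U i" "compact K" "ennreal (measure \<mu> (U i) - \<eta>) < emeasure \<mu> K"
      unfolding less_SUP_iff by blast
    then show ?thesis
      using False by (intro exI[of _ K]) (simp add: emeasure_eq_measure ennreal_less_iff)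
  qed
  then obtain K where K: "\<And>i. K i \<subseteq> U i" "\<And>i. compact (K i)"
    "\<And>i. measure \<mu> (U i) - \<eta> \<le> measure \<mu> (K i)"
    by metis
  have Kb: "K i \<in> sets borel" for i
    using K(2) by (simp add: borel_compact)
  show thesis
  proof (rule that[of I enn2real K])
    show "disjoint_family_on K I"
      unfolding disjoint_family_on_def
    proof (intro ballI impI)
      fix i j :: ennreal assume "i \<noteq> j"
      then show "K i \<inter> K j = {}"
        using K(1)[of i] K(1)[of j] by (auto simp: U_def)
    qed
    show "enn2real i * measure lborel E \<le> measure \<mu> E" if "i \<in> I" "E \<in> sets borel" "E \<subseteq> K i" for i E
      using that(3) K(1)[of i] by (intro low' that(1,2)) (rule subset_trans)
    have "enn2real i * measure lborel (U i) - \<eta> \<le> enn2real i * measure lborel (K i)" if "i \<in> I" for i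
    proof -
      have "measure lborel (U i) = measure lborel (K i) + measure lborel (U i - K i)"
        using measure_Diff[of lborel "U i" "K i"] fin_U[OF U order_refl that] U Kb K(1)
        by (simp add: less_top)
      moreover have "enn2real i * measure lborel (U i - K i) \<le> measure \<mu> (U i - K i)"
        by (intro low' that sets.Diff U Kb Diff_subset)
      moreover have "measure \<mu> (U i - K i) \<le> \<eta>"
        using finite_measure_Diff[of "U i" "K i"] U Kb K(1,3)[of i] sets by simp
      ultimately show ?thesis
        by (simp add: distrib_left)
    qed
    then have "(\<Sum>i\<in>I. enn2real i * measure lborel (U i) - \<eta>) \<le> (\<Sum>i\<in>I. enn2real i * measure lborel (K i))"
      by (rule sum_mono)
    moreover have "card I * \<eta> \<le> \<epsilon> / 2"
      using \<epsilon> by (simp add: \<eta>_def field_simps)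
    ultimately show "1 - \<epsilon> \<le> (\<Sum>i\<in>I. enn2real i * measure lborel (K i))"
      using sum_U by (simp add: sum_subtractf)
  qed (use fin K(2) in auto)
qed

lemma compact_outer_open:
  fixes K :: "'a::euclidean_space set"
  assumes "compact K" "0 < \<eta>"
  obtains V where "open V" "V \<in> lmeasurable" "K \<subseteq> V" "measure lebesgue V \<le> measure lebesgue K + \<eta>"
proof -
  have K: "K \<in> lmeasurable"
    by (rule lmeasurable_compact[OF assms(1)])
  obtain V where V: "open V" "K \<subseteq> V" "V - K \<in> lmeasurable" "emeasure lebesgue (V - K) < ennreal \<eta>"
    using sets_lebesgue_outer_open[OF fmeasurableD[OF K] assms(2)] by blast
  have eq: "V = (V - K) \<union> K"
    using V(2) by blast
  have "measure lebesgue V \<le> measure lebesgue (V - K) + measure lebesgue K"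
    using measure_Un_le[of "V - K" lebesgue K] eq V(3) K by (metis fmeasurableD)
  moreover have "measure lebesgue (V - K) \<le> \<eta>"
    using V(3,4) assms(2) by (simp add: emeasure_eq_measure2 ennreal_less_iff)
  moreover have "V \<in> lmeasurable"
    using V(3) K eq by (metis fmeasurable.Un)
  ultimately show ?thesis
    using that V(1,2) by simp
qed

section \<open>Coverings of compact sets by the cubes A^n Q\<close>

context integral_IFS_measure
begin

abbreviation "\<delta> \<equiv> \<bar>det A\<bar>"

lemma delta_pos: "0 < \<delta>"
  using invertible_A by (simp add: invertible_det_nz)

lemma measure_iter_image_lebesgue:
  assumes "E \<in> lmeasurable"
  shows "iter n ` E \<in> lmeasurable" "measure lebesgue (iter n ` E) = \<delta> ^ n * measure lebesgue E"
  using measure_funpow_matrix_image[OF assms] by auto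

definition hitting :: "nat \<Rightarrow> (real^'n) set \<Rightarrow> (real^'n) set" where
  "hitting n K = {z. int_vec z \<and> iter n ` unit_cube z \<inter> K \<noteq> {}}"

lemma hitting_cover: "K \<subseteq> (\<Union>z\<in>hitting n K. iter n ` unit_cube z)"
proof
  fix x assume x: "x \<in> K"
  obtain z where z: "int_vec z" "((*v) B ^^ n) x \<in> unit_cube z"
    using unit_cube_exists by blast
  then have "x \<in> iter n ` unit_cube z"
    by (metis funpow_matrix_inv(2)[OF invertible_A] image_eqI)
  with x z show "x \<in> (\<Union>z\<in>hitting n K. iter n ` unit_cube z)"
    by (auto simp: hitting_def)
qed

lemma sum_lebesgue_iter_cubes:
  assumes "finite F" "F \<subseteq> Collect int_vec"
  shows "measure lebesgue (\<Union>z\<in>F. iter n ` unit_cube z) = card F * \<delta> ^ n"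
proof -
  have lm: "iter n ` unit_cube z \<in> lmeasurable" for z :: "real^'n"
    by (intro measure_iter_image_lebesgue lmeasurable_unit_cube)
  have "measure lebesgue (\<Union>z\<in>F. iter n ` unit_cube z)
      = (\<Sum>z\<in>F. measure lebesgue (iter n ` unit_cube z))"
    using fmeasurableD2[OF lm]
    by (intro measure_finite_Union assms(1) disjoint_family_on_mono[OF assms(2) disjoint_iter_cubes]
        image_subsetI fmeasurableD lm) (simp del: emeasure_completion)
  also have "\<dots> = (\<Sum>z\<in>F. \<delta> ^ n)"
    by (simp add: measure_iter_image_lebesgue(2)[OF lmeasurable_unit_cube] measure_unit_cube
        del: measure_completion)
  finally show ?thesis by simp
qed

text \<open>The diameters of the cubes A^n Q tend to 0 uniformly, so those meeting \<open>K\<close>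
  eventually lie in \<open>V\<close>. They are disjoint and each has volume \<delta>^n.\<close>

lemma eventually_card_hitting:
  assumes K: "compact K" and V: "open V" "V \<in> lmeasurable" "K \<subseteq> V"
  shows "\<forall>\<^sub>F n in sequentially. finite (hitting n K) \<and> card (hitting n K) * \<delta> ^ n \<le> measure lebesgue V"
proof -
  let ?q = "onorm ((*v) A)"
  obtain e where e: "0 < e" "(\<Union>x\<in>K. ball x e) \<subseteq> V"
    using compact_subset_open_imp_ball_epsilon_subset[OF K V(1,3)] by blast
  have q: "0 \<le> ?q"
    by (intro onorm_pos_le) simp
  have "(\<lambda>n. ?q ^ n * CARD('n)) \<longlonglongrightarrow> 0 * real CARD('n)"
    using q contracting by (intro tendsto_intros LIMSEQ_power_zero) simp
  then have "\<forall>\<^sub>F n in sequentially. ?q ^ n * CARD('n) < e"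
    using e(1) by (intro order_tendstoD(2)) auto
  then show ?thesis
  proof eventually_elim
    case (elim n)
    have sub: "iter n ` unit_cube z \<subseteq> V" if "z \<in> hitting n K" for z
    proof
      fix y assume "y \<in> iter n ` unit_cube z"
      then obtain y' where y': "y = iter n y'" "y' \<in> unit_cube z" by blast
      obtain k' where k': "iter n k' \<in> K" "k' \<in> unit_cube z"
        using \<open>z \<in> hitting n K\<close> by (auto simp: hitting_def)
      have "iter n k' - iter n y' = iter n (k' - y')"
        by (rule linear_diff[symmetric, OF linear_funpow[OF matrix_vector_mul_linear]])
      then have "dist (iter n k') y \<le> ?q ^ n * norm (k' - y')"
        using norm_funpow_matrix[of n A "k' - y'"] by (simp add: dist_norm y')
      also have "\<dots> \<le> ?q ^ n * CARD('n)"
        using q by (intro mult_left_mono norm_diff_unit_cube[OF k'(2) y'(2)]) simp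
      finally have "y \<in> ball (iter n k') e"
        using elim by simp
      then show "y \<in> V"
        using e(2) k'(1) by blast
    qed
    \<comment> \<open>Finite subsets come first: \<open>card\<close> of an infinite set is 0, so the
      estimate for the whole set says nothing until finiteness is known.\<close>
    have bound: "card G * \<delta> ^ n \<le> measure lebesgue V" if "G \<subseteq> hitting n K" "finite G" for G
    proof -
      have G: "G \<subseteq> Collect int_vec"
        using that by (auto simp: hitting_def)
      have "(\<Union>z\<in>G. iter n ` unit_cube z) \<in> sets lebesgue"
        using sets_iter[OF sets_unit_cube] that(2) by (intro sets.finite_UN) auto
      then have "measure lebesgue (\<Union>z\<in>G. iter n ` unit_cube z) \<le> measure lebesgue V"
        using sub that V(2) by (intro measure_mono_fmeasurable) auto
      then show ?thesis
        by (simp add: sum_lebesgue_iter_cubes[OF that(2) G])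
    qed
    have "card G \<le> nat \<lceil>measure lebesgue V / \<delta> ^ n\<rceil>" if "G \<subseteq> hitting n K" "finite G" for G
    proof -
      have "card G \<le> measure lebesgue V / \<delta> ^ n"
        using bound[OF that] delta_pos by (simp only: pos_le_divide_eq zero_less_power)
      also have "\<dots> \<le> nat \<lceil>measure lebesgue V / \<delta> ^ n\<rceil>"
        by (rule real_nat_ceiling_ge)
      finally show ?thesis
        by (simp only: of_nat_le_iff)
    qed
    then have "finite (hitting n K)"
      using finite_if_finite_subsets_card_bdd by blast
    then show ?case
      using bound by blast
  qed
qed

text \<open>Cauchy-Schwarz over the cubes that meet \<open>K\<close>: the squared sum of their
  measures is at most their number times the energy.\<close>

lemma eventually_measure_compact_le:
  assumes K: "compact K" and V: "open V" "V \<in> lmeasurable" "K \<subseteq> V"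
  shows "\<forall>\<^sub>F n in sequentially. (measure \<mu> K)\<^sup>2 \<le> measure lebesgue V * (energy n / \<delta> ^ n)"
  using eventually_card_hitting[OF assms]
proof eventually_elim
  case (elim n)
  let ?H = "hitting n K"
  have H: "finite ?H" "?H \<subseteq> Collect int_vec"
    using elim by (auto simp: hitting_def)
  have "measure \<mu> K \<le> measure \<mu> (\<Union>z\<in>?H. iter n ` unit_cube z)"
    using H(1) sets_iter[OF sets_unit_cube]
    by (intro finite_measure_mono hitting_cover sets.finite_UN) auto
  also have "\<dots> \<le> (\<Sum>z\<in>?H. measure \<mu> (iter n ` unit_cube z))"
    using H(1) sets_iter[OF sets_unit_cube] by (intro measure_UNION_le) auto
  finally have "(measure \<mu> K)\<^sup>2 \<le> (\<Sum>z\<in>?H. 1 * measure \<mu> (iter n ` unit_cube z))\<^sup>2"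
    by (intro power_mono) auto
  also have "\<dots> \<le> (\<Sum>z\<in>?H. 1\<^sup>2) * (\<Sum>z\<in>?H. (measure \<mu> (iter n ` unit_cube z))\<^sup>2)"
    by (rule Cauchy_Schwarz_ineq_sum)
  also have "\<dots> \<le> card ?H * energy n"
    using finite_sum_le_energy[OF H] by (simp add: mult_left_mono)
  also have "\<dots> = card ?H * \<delta> ^ n * (energy n / \<delta> ^ n)"
    using delta_pos by simp
  also have "\<dots> \<le> measure lebesgue V * (energy n / \<delta> ^ n)"
  proof (rule mult_right_mono)
    show "0 \<le> energy n / \<delta> ^ n"
      using finite_sum_le_energy[of "{}" n] delta_pos by simp
  qed (use elim in simp)
  finally show ?case .
qed

text \<open>If r < \<delta>, the energy divided by \<delta>^n tends to 0 and compact sets become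
  null, against \<open>charged_cube\<close>.\<close>

lemma delta_le_of_energy_le:
  assumes "\<And>n. energy n \<le> r ^ n" "0 < r"
  shows "\<delta> \<le> r"
proof (rule ccontr)
  assume "\<not> \<delta> \<le> r"
  then have r: "r / \<delta> < 1" "0 < r / \<delta>"
    using delta_pos assms(2) by simp_all
  obtain y where y: "0 < measure \<mu> (unit_cube y)"
    using charged_cube by blast
  let ?K = "cbox y (y + 1)"
  obtain V where V: "open V" "V \<in> lmeasurable" "?K \<subseteq> V"
    by (metis bounded_cbox bounded_subset_ballD lmeasurable_ball open_ball)
  have "(\<lambda>n. measure lebesgue V * (r / \<delta>) ^ n) \<longlonglongrightarrow> measure lebesgue V * 0"
    using r by (intro tendsto_intros LIMSEQ_power_zero) simp
  moreover have "\<forall>\<^sub>F n in sequentially. (measure \<mu> ?K)\<^sup>2 \<le> measure lebesgue V * (r / \<delta>) ^ n"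
    using eventually_measure_compact_le[OF compact_cbox V]
  proof eventually_elim
    case (elim n)
    have "measure lebesgue V * (energy n / \<delta> ^ n) \<le> measure lebesgue V * (r ^ n / \<delta> ^ n)"
      using assms(1) delta_pos by (intro mult_left_mono divide_right_mono) auto
    with elim show ?case
      by (simp add: power_divide)
  qed
  ultimately have "(measure \<mu> ?K)\<^sup>2 \<le> measure lebesgue V * 0"
    by (intro tendsto_lowerbound) auto
  then have "measure \<mu> ?K = 0"
    by simp
  moreover have "measure \<mu> (unit_cube y) \<le> measure \<mu> ?K"
    by (intro finite_measure_mono unit_cube_subset_cbox) simp
  ultimately show False
    using y by simp
qed

text \<open>The squared \<mu>-measure of a compact Lebesgue null set is at most the volume of any
  open neighbourhood of finite volume, hence 0. Inner regularity passes from compact to Borel null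
  sets.\<close>

lemma absolutely_continuous_of_energy_le:
  assumes "\<And>n. energy n \<le> \<delta> ^ n"
  shows "absolutely_continuous lborel \<mu>"
  unfolding absolutely_continuous_def
proof
  fix E assume "E \<in> null_sets (lborel :: (real^'n) measure)"
  then have E: "E \<in> sets borel" "emeasure lborel E = 0"
    by (auto simp: null_sets_def)
  have "measure \<mu> K = 0" if K: "compact K" "K \<subseteq> E" for K
  proof -
    have Kb: "K \<in> sets borel"
      using K(1) by (simp add: borel_compact)
    have "emeasure lborel K = 0"
      using emeasure_mono[of K E lborel] K(2) E by simp
    then have Knull: "K \<in> null_sets lebesgue"
      using Kb by (simp add: null_sets_def)
    have "(measure \<mu> K)\<^sup>2 \<le> \<eta>" if \<eta>: "0 < \<eta>" for \<eta>
    proof -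
      obtain V where V: "open V" "V \<in> lmeasurable" "K \<subseteq> V"
        "measure lebesgue V \<le> measure lebesgue K + \<eta>"
        by (rule compact_outer_open[OF K(1) \<eta>])
      then have *: "measure lebesgue V \<le> \<eta>"
        using Knull by (simp add: measure_eq_0_null_sets)
      obtain n where "(measure \<mu> K)\<^sup>2 \<le> measure lebesgue V * (energy n / \<delta> ^ n)"
        using eventually_happens[OF eventually_measure_compact_le[OF K(1) V(1,2,3)]] by auto
      also have "\<dots> \<le> measure lebesgue V * 1"
        using assms[of n] delta_pos by (intro mult_left_mono) auto
      finally show ?thesis using * by simp
    qed
    then have "(measure \<mu> K)\<^sup>2 \<le> 0"
      by (rule dense_ge)
    then show ?thesis by simp
  qed
  moreover have "emeasure \<mu> E = (SUP K\<in>{K. K \<subseteq> E \<and> compact K}. emeasure \<mu> K)"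
    by (rule inner_regular) (use E in auto)
  ultimately have "emeasure \<mu> E = 0"
    by (auto simp: emeasure_eq_measure intro!: SUP_eq_const)
  then show "E \<in> null_sets \<mu>"
    using E(1) by (simp add: null_sets_def)
qed

end

section \<open>Periodic sets and periodizations\<close>

definition periodic :: "(real^'n) set \<Rightarrow> bool" where
  "periodic F \<longleftrightarrow> (\<forall>x z. int_vec z \<longrightarrow> (x + z \<in> F \<longleftrightarrow> x \<in> F))"

lemma measure_periodic_Int_unit_cube:
  assumes "periodic F" "int_vec z"
  shows "measure lebesgue (F \<inter> unit_cube z) = measure lebesgue (F \<inter> unit_cube 0)"
proof -
  have "F \<inter> unit_cube z = (+) z ` (F \<inter> unit_cube 0)"
  proof (intro equalityI subsetI)
    fix x assume x: "x \<in> F \<inter> unit_cube z"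
    have "x - z + z \<in> F \<longleftrightarrow> x - z \<in> F"
      using assms unfolding periodic_def by blast
    then have "x - z \<in> F \<inter> unit_cube 0"
      using x by (auto simp: unit_cube_def algebra_simps)
    then show "x \<in> (+) z ` (F \<inter> unit_cube 0)"
      by (auto intro!: image_eqI[of _ _ "x - z"])
  next
    fix x assume "x \<in> (+) z ` (F \<inter> unit_cube 0)"
    then obtain y where y: "x = y + z" "y \<in> F" "y \<in> unit_cube 0"
      by (auto simp: add.commute)
    moreover have "y + z \<in> F \<longleftrightarrow> y \<in> F"
      using assms unfolding periodic_def by blast
    ultimately show "x \<in> F \<inter> unit_cube z"
      by (auto simp: unit_cube_def algebra_simps)
  qed
  then show ?thesis
    by (simp only: measure_translation)
qed

definition periodization :: "(real^'n) set \<Rightarrow> (real^'n) set" where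
  "periodization E = (\<Union>z\<in>Collect int_vec. (+) z ` E)"

lemma periodization_iff: "x \<in> periodization E \<longleftrightarrow> (\<exists>z. int_vec z \<and> x - z \<in> E)"
  by (auto simp: periodization_def image_iff) (metis add.commute diff_add_cancel)

lemma periodic_periodization:
  fixes E :: "(real^'n) set"
  shows "periodic (periodization E)"
  unfolding periodic_def
proof (intro allI impI)
  fix x z :: "real^'n" assume z: "int_vec z"
  show "x + z \<in> periodization E \<longleftrightarrow> x \<in> periodization E"
  proof
    assume "x + z \<in> periodization E"
    then obtain w where "int_vec w" "x + z - w \<in> E"
      by (auto simp: periodization_iff)
    then show "x \<in> periodization E"
      using z unfolding periodization_iff by (intro exI[of _ "w - z"]) (simp add: algebra_simps)
  next
    assume "x \<in> periodization E"
    then obtain w where "int_vec w" "x - w \<in> E"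
      by (auto simp: periodization_iff)
    then show "x + z \<in> periodization E"
      using z unfolding periodization_iff by (intro exI[of _ "w + z"]) (simp add: algebra_simps)
  qed
qed

lemma subset_periodization: "E \<subseteq> periodization E"
  by (auto simp: periodization_iff intro!: exI[of _ 0])

lemma sets_translation_borel:
  fixes E :: "'a::euclidean_space set"
  assumes "E \<in> sets borel"
  shows "(+) z ` E \<in> sets borel"
proof -
  have "(+) z ` E = (\<lambda>x. x - z) -` E"
    by (auto simp: image_iff algebra_simps intro!: bexI[of _ "_ - z"])
  then show ?thesis
    using measurable_sets[of "\<lambda>x. x - z" borel borel E] assms by simp
qed

lemma sets_periodization: "E \<in> sets borel \<Longrightarrow> periodization E \<in> sets borel"
  unfolding periodization_def
  by (intro sets.countable_UN' countable_int_vec) (auto intro: sets_translation_borel)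

text \<open>Subadditivity in terms of a counting integral, to match the form of
  \<open>emeasure_UN_countable\<close> for disjoint families; both are combined in
  \<open>measure_periodization_le\<close>.\<close>

lemma emeasure_UN_countable_le:
  assumes I: "countable I" and X: "\<And>i. i \<in> I \<Longrightarrow> X i \<in> sets M"
  shows "emeasure M (\<Union>i\<in>I. X i) \<le> (\<integral>\<^sup>+i. emeasure M (X i) \<partial>count_space I)"
proof -
  have "(\<Union>i\<in>I. X i) \<in> sets M"
    using X by (intro sets.countable_UN' I) auto
  then have "emeasure M (\<Union>i\<in>I. X i) = (\<integral>\<^sup>+x. indicator (\<Union>i\<in>I. X i) x \<partial>M)"
    by simp
  also have "\<dots> \<le> (\<integral>\<^sup>+x. \<integral>\<^sup>+i. indicator (X i) x \<partial>count_space I \<partial>M)"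
  proof (rule nn_integral_mono)
    fix x
    show "indicator (\<Union>i\<in>I. X i) x \<le> (\<integral>\<^sup>+i. indicator (X i) x \<partial>count_space I)"
    proof (cases "x \<in> (\<Union>i\<in>I. X i)")
      case True
      then obtain i where "i \<in> I" "x \<in> X i" by blast
      then show ?thesis
        using nn_integral_ge_point[of i I "\<lambda>i. indicator (X i) x"] True by simp
    qed simp
  qed
  also have "\<dots> = (\<integral>\<^sup>+i. \<integral>\<^sup>+x. indicator (X i) x \<partial>M \<partial>count_space I)"
    using X by (intro nn_integral_count_space_nn_integral I) simp
  also have "\<dots> = (\<integral>\<^sup>+i. emeasure M (X i) \<partial>count_space I)"
    using X by (intro nn_integral_cong) simp
  finally show ?thesis .
qed

text \<open>Folding \<open>E\<close> into the unit cube translates its pieces, and overlaps between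
  the folded pieces can only lose volume.\<close>

lemma measure_periodization_le:
  fixes E :: "(real^'n) set"
  assumes E: "E \<in> sets borel" "E \<in> lmeasurable"
  shows "measure lebesgue (periodization E \<inter> unit_cube 0) \<le> measure lebesgue E"
proof -
  have tr: "emeasure lborel ((+) z ` X) = emeasure lborel X" if "X \<in> sets borel" for z and X :: "(real^'n) set"
  proof -
    have "emeasure lborel X = emeasure (distr lborel borel ((+) z)) ((+) z ` X)"
      using that sets_translation_borel[OF that]
      by (subst emeasure_distr) (simp_all add: inj_vimage_image_eq)
    then show ?thesis
      by (simp add: lborel_distr_plus)
  qed
  have "emeasure lborel (periodization E \<inter> unit_cube 0)
      = emeasure lborel (\<Union>z\<in>Collect int_vec. (+) z ` E \<inter> unit_cube 0)"
    by (simp add: periodization_def)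
  also have "\<dots> \<le> (\<integral>\<^sup>+z. emeasure lborel ((+) z ` E \<inter> unit_cube 0) \<partial>count_space (Collect int_vec))"
    by (intro emeasure_UN_countable_le countable_int_vec)
       (auto intro!: sets.Int sets_translation_borel E sets_unit_cube)
  \<comment> \<open>The translation moves from the set to the cube: the pieces, which may overlap
    after folding, become disjoint parts of \<open>E\<close>.\<close>
  also have "\<dots> = (\<integral>\<^sup>+z. emeasure lborel (E \<inter> unit_cube (- z)) \<partial>count_space (Collect int_vec))"
  proof (intro nn_integral_cong)
    fix z :: "real^'n"
    have "z + x \<in> unit_cube 0 \<longleftrightarrow> x \<in> unit_cube (- z)" for x
      using translate_vimage_unit_cube[of z 0] by (auto simp: vimage_def set_eq_iff add.commute)
    then have eq: "(+) z ` E \<inter> unit_cube 0 = (+) z ` (E \<inter> unit_cube (- z))"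
      by auto
    show "emeasure lborel ((+) z ` E \<inter> unit_cube 0) = emeasure lborel (E \<inter> unit_cube (- z))"
      unfolding eq by (intro tr sets.Int E sets_unit_cube)
  qed
  also have "\<dots> = emeasure lborel (\<Union>z\<in>Collect int_vec. E \<inter> unit_cube (- z))"
  proof (rule emeasure_UN_countable[symmetric])
    show "disjoint_family_on (\<lambda>z. E \<inter> unit_cube (- z)) (Collect int_vec)"
    proof (unfold disjoint_family_on_def, intro ballI impI)
      fix z w :: "real^'n" assume "z \<in> Collect int_vec" "w \<in> Collect int_vec" "z \<noteq> w"
      then show "(E \<inter> unit_cube (- z)) \<inter> (E \<inter> unit_cube (- w)) = {}"
        using unit_cube_unique[of "- z" "- w"] by fastforce
    qed
  qed (auto intro!: sets.Int E sets_unit_cube countable_int_vec)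
  also have "\<dots> \<le> emeasure lborel E"
    by (intro emeasure_mono) (auto intro: E)
  finally have "emeasure lebesgue (periodization E \<inter> unit_cube 0) \<le> emeasure lebesgue E"
    using E sets_periodization[OF E(1)] by (simp add: sets.Int)
  moreover have "periodization E \<inter> unit_cube 0 \<in> lmeasurable"
    by (rule lmeasurable_subset_unit_cube[of _ 0]) (auto intro: sets.Int sets_periodization sets_unit_cube E)
  ultimately show ?thesis
    using E(2) by (simp only: emeasure_eq_measure2 ennreal_le_iff measure_nonneg)
qed

section \<open>Equidistribution of the images of periodic sets\<close>

context integral_IFS_measure
begin

text \<open>Endpoints are integer vectors, so every translate in \<open>measure_iter_image\<close>
  is \<open>F\<close> itself.\<close>

lemma measure_iter_periodic:
  assumes "F \<in> sets borel" "periodic F"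
  shows "measure \<mu> (iter n ` F) = measure \<mu> F"
proof -
  have "(\<lambda>x. x + endpoint w) -` F = F" if "w \<in> words n" for w
    using assms(2) int_vec_endpoint[OF that] by (auto simp: periodic_def)
  then show ?thesis
    using assms(1) by (simp add: measure_iter_image sum_distrib_right[symmetric] sum_weight)
qed

text \<open>The set A^n F fills the same share of every cube A^n Q, namely the density of
  \<open>F\<close>, and the cubes meeting \<open>K\<close> eventually have total volume at most that
  of \<open>V\<close>.\<close>

lemma eventually_measure_iter_periodic_le:
  assumes F: "F \<in> sets borel" "periodic F"
    and K: "compact K" and V: "open V" "V \<in> lmeasurable" "K \<subseteq> V"
  shows "\<forall>\<^sub>F n in sequentially. measure lebesgue (iter n ` F \<inter> K)
    \<le> measure lebesgue (F \<inter> unit_cube 0) * measure lebesgue V"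
  using eventually_card_hitting[OF K V]
proof eventually_elim
  case (elim n)
  let ?H = "hitting n K" and ?e = "measure lebesgue (F \<inter> unit_cube 0)"
  have lm: "F \<inter> unit_cube z \<in> lmeasurable" for z
    using F(1) by (intro lmeasurable_subset_unit_cube[of _ z] sets.Int sets_unit_cube) auto
  have "iter n ` F \<inter> K \<subseteq> (\<Union>z\<in>?H. iter n ` (F \<inter> unit_cube z))"
  proof
    fix x assume x: "x \<in> iter n ` F \<inter> K"
    then obtain z where "z \<in> ?H" "x \<in> iter n ` unit_cube z"
      using hitting_cover by blast
    with x show "x \<in> (\<Union>z\<in>?H. iter n ` (F \<inter> unit_cube z))"
      using image_Int[OF inj_iter, of n F "unit_cube z"] by blast
  qed
  moreover have "(\<Union>z\<in>?H. iter n ` (F \<inter> unit_cube z)) \<in> lmeasurable"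
    by (rule fmeasurable.finite_UN) (use elim measure_iter_image_lebesgue(1)[OF lm] in simp_all)
  moreover have "iter n ` F \<inter> K \<in> sets lebesgue"
    using sets.Int[OF sets_iter[OF F(1)] borel_compact[OF K]] by simp
  ultimately have "measure lebesgue (iter n ` F \<inter> K) \<le> measure lebesgue (\<Union>z\<in>?H. iter n ` (F \<inter> unit_cube z))"
    by (intro measure_mono_fmeasurable)
  also have "\<dots> \<le> (\<Sum>z\<in>?H. measure lebesgue (iter n ` (F \<inter> unit_cube z)))"
    using elim by (intro measure_UNION_le fmeasurableD measure_iter_image_lebesgue lm) simp
  also have "\<dots> = (\<Sum>z\<in>?H. \<delta> ^ n * ?e)"
  proof (rule sum.cong[OF refl])
    fix z assume "z \<in> ?H"
    then have "measure lebesgue (F \<inter> unit_cube z) = ?e"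
      by (intro measure_periodic_Int_unit_cube F(2)) (simp add: hitting_def)
    then show "measure lebesgue (iter n ` (F \<inter> unit_cube z)) = \<delta> ^ n * ?e"
      by (simp only: measure_iter_image_lebesgue(2)[OF lm])
  qed
  also have "\<dots> = ?e * (card ?H * \<delta> ^ n)"
    by (simp add: mult_ac)
  also have "\<dots> \<le> ?e * measure lebesgue V"
    using elim by (intro mult_left_mono) auto
  finally show ?case .
qed

text \<open>The sets \<open>iter n ` F\<close> have the same measure as \<open>F\<close> and become equidistributed.\<close>

lemma measure_periodic_le_approx:
  assumes ac: "absolutely_continuous lborel \<mu>" and F: "F \<in> sets borel" "periodic F" and \<epsilon>: "0 < \<epsilon>"
  defines "e \<equiv> measure lebesgue (F \<inter> unit_cube 0)"
  shows "measure \<mu> F \<le> e + (1 + e) * \<epsilon>"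
proof -
  have e0: "0 \<le> e"
    by (simp add: e_def)
  obtain I :: "ennreal set" and c K where I: "finite I" and c: "\<And>i. i \<in> I \<Longrightarrow> 0 \<le> c i"
    and K: "\<And>i. i \<in> I \<Longrightarrow> compact (K i)" and disj: "disjoint_family_on K I"
    and low: "\<And>i E. i \<in> I \<Longrightarrow> E \<in> sets borel \<Longrightarrow> E \<subseteq> K i \<Longrightarrow>
      c i * measure lborel E \<le> measure \<mu> E"
    and total: "1 - \<epsilon> \<le> (\<Sum>i\<in>I. c i * measure lborel (K i))"
    by (rule density_compact_approx[OF prob_space_axioms sets_mu ac \<epsilon>]) blast
  have Kb: "K i \<in> sets borel" "K i \<in> lmeasurable" if "i \<in> I" for i
    using K[OF that] by (simp_all add: borel_compact lmeasurable_compact)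
  \<comment> \<open>Chosen so that the errors \<open>c i * \<eta>\<close> add up to at most
    \<epsilon>; the summand 1 covers the case that all \<open>c i\<close> vanish.\<close>
  define \<eta> where "\<eta> = \<epsilon> / (1 + sum c I)"
  have c1: "0 \<le> sum c I"
    using c by (rule sum_nonneg)
  then have \<eta>0: "0 < \<eta>"
    using \<epsilon> by (simp add: \<eta>_def)
  have "sum c I * \<eta> \<le> (1 + sum c I) * \<eta>"
    using \<eta>0 by simp
  also have "\<dots> = \<epsilon>"
    using c1 by (simp add: \<eta>_def)
  finally have \<eta>: "sum c I * \<eta> \<le> \<epsilon>" .
  have "\<forall>\<^sub>F n in sequentially. \<forall>i\<in>I.
      measure lebesgue (iter n ` F \<inter> K i) \<le> e * (measure lebesgue (K i) + \<eta>)"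
  \<comment> \<open>There are finitely many compact sets, so one \<open>n\<close> serves them
    all.\<close>
  proof (rule eventually_ball_finite[OF I], rule ballI)
    fix i assume i: "i \<in> I"
    obtain V where V: "open V" "V \<in> lmeasurable" "K i \<subseteq> V"
      "measure lebesgue V \<le> measure lebesgue (K i) + \<eta>"
      by (rule compact_outer_open[OF K[OF i] \<eta>0])
    have "e * measure lebesgue V \<le> e * (measure lebesgue (K i) + \<eta>)"
      using e0 V(4) by (rule mult_left_mono[rotated])
    then show "\<forall>\<^sub>F n in sequentially.
        measure lebesgue (iter n ` F \<inter> K i) \<le> e * (measure lebesgue (K i) + \<eta>)"
      using eventually_measure_iter_periodic_le[OF F K[OF i] V(1,2,3)]
      unfolding e_def[symmetric] by (auto elim: eventually_mono)
  qed
  then obtain n where "\<forall>i\<in>I. measure lebesgue (iter n ` F \<inter> K i) \<le> e * (measure lebesgue (K i) + \<eta>)"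
    using eventually_happens[of _ sequentially] by auto
  then have n: "measure lebesgue (iter n ` F \<inter> K i) \<le> e * (measure lebesgue (K i) + \<eta>)" if "i \<in> I" for i
    using that by blast
  define X where "X = iter n ` F"
  have X: "X \<in> sets borel"
    unfolding X_def by (rule sets_iter[OF F(1)])
  have lebK: "measure lborel (K i - X) = measure lborel (K i) - measure lborel (X \<inter> K i)" if "i \<in> I" for i
  proof -
    have "K i - X = K i - X \<inter> K i" by blast
    moreover have "measure lborel (K i - X \<inter> K i) = measure lborel (K i) - measure lborel (X \<inter> K i)"
      using Kb[OF that] X by (intro measure_Diff) (auto simp: fmeasurable_def)
    ultimately show ?thesis by simp
  qed
  have sub: "(\<Sum>i\<in>I. measure \<mu> (E i)) \<le> measure \<mu> Y"
    if E: "\<And>i. i \<in> I \<Longrightarrow> E i \<in> sets borel" "\<And>i. i \<in> I \<Longrightarrow> E i \<subseteq> K i \<inter> Y" and Y: "Y \<in> sets borel"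
    for E Y
  proof -
    have "E i \<inter> E j = {}" if "i \<in> I" "j \<in> I" "i \<noteq> j" for i j
      using E(2)[OF that(1)] E(2)[OF that(2)] disjoint_family_onD[OF disj that] by blast
    then have "disjoint_family_on E I"
      by (simp add: disjoint_family_on_def)
    then have "(\<Sum>i\<in>I. measure \<mu> (E i)) = measure \<mu> (\<Union>i\<in>I. E i)"
      using I E(1) by (intro finite_measure_finite_Union[symmetric] image_subsetI) auto
    also have "\<dots> \<le> measure \<mu> Y"
      using E(2) Y by (intro finite_measure_mono UN_least) auto
    finally show ?thesis .
  qed
  have "(\<Sum>i\<in>I. c i * measure lborel (K i)) \<le> (\<Sum>i\<in>I. measure \<mu> (K i))"
    by (intro sum_mono low Kb order_refl)
  also have "\<dots> \<le> measure \<mu> UNIV"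
    by (intro sub Kb) auto
  finally have upper: "(\<Sum>i\<in>I. c i * measure lborel (K i)) \<le> 1"
    using prob_space by simp
  \<comment> \<open>\<open>low\<close> bounds \<mu> only from below, so the upper bound for
    \<open>X\<close> comes from a lower bound for its complement.\<close>
  have "(\<Sum>i\<in>I. c i * (measure lborel (K i) - measure lborel (X \<inter> K i)))
      = (\<Sum>i\<in>I. c i * measure lborel (K i - X))"
    by (intro sum.cong refl) (simp add: lebK)
  also have "\<dots> \<le> (\<Sum>i\<in>I. measure \<mu> (K i - X))"
    by (intro sum_mono low sets.Diff Kb X Diff_subset)
  also have "\<dots> \<le> measure \<mu> (- X)"
    by (intro sub sets.Diff Kb X) (use X in auto)
  also have "\<dots> = 1 - measure \<mu> F"
    using prob_compl[of X] X measure_iter_periodic[OF F, of n] by (simp add: Compl_eq_Diff_UNIV X_def)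
  finally have "measure \<mu> F \<le> 1 - (\<Sum>i\<in>I. c i * measure lborel (K i)) + (\<Sum>i\<in>I. c i * measure lborel (X \<inter> K i))"
    by (simp add: right_diff_distrib sum_subtractf)
  also have "\<dots> \<le> \<epsilon> + (\<Sum>i\<in>I. c i * (e * (measure lborel (K i) + \<eta>)))"
  proof (intro add_mono sum_mono mult_left_mono c)
    fix i assume i: "i \<in> I"
    then show "measure lborel (X \<inter> K i) \<le> e * (measure lborel (K i) + \<eta>)"
      using n[OF i] X Kb(1)[OF i] by (simp add: X_def)
  qed (use total in auto)
  also have "(\<Sum>i\<in>I. c i * (e * (measure lborel (K i) + \<eta>)))
      = e * ((\<Sum>i\<in>I. c i * measure lborel (K i)) + sum c I * \<eta>)"
    by (simp add: sum_distrib_left sum_distrib_right sum.distrib distrib_left mult_ac)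
  also have "\<epsilon> + \<dots> \<le> \<epsilon> + e * (1 + \<epsilon>)"
    using upper \<eta> e0 by (intro add_left_mono mult_left_mono add_mono)
  finally show ?thesis
    by (simp add: algebra_simps)
qed

lemma measure_periodic_le:
  assumes "absolutely_continuous lborel \<mu>" "F \<in> sets borel" "periodic F"
  shows "measure \<mu> F \<le> measure lebesgue (F \<inter> unit_cube 0)"
proof (rule field_le_epsilon)
  let ?e = "measure lebesgue (F \<inter> unit_cube 0)"
  fix t :: real assume "0 < t"
  have e: "0 < 1 + ?e"
    by (rule add_pos_nonneg) simp_all
  with \<open>0 < t\<close> have "0 < t / (1 + ?e)"
    by simp
  from measure_periodic_le_approx[OF assms this] e show "measure \<mu> F \<le> ?e + t"
    by simp
qed

text \<open>The periodization of a cube A^n Q has density at most \<delta>^n, hence so has its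
  \<mu>-measure. The sum of squares is then at most this bound times the total mass.\<close>

lemma energy_le_of_absolutely_continuous:
  assumes "absolutely_continuous lborel \<mu>"
  shows "energy n \<le> \<delta> ^ n"
proof -
  have cube: "measure \<mu> (iter n ` unit_cube z) \<le> \<delta> ^ n" for z
  proof -
    let ?E = "iter n ` unit_cube z"
    have E: "?E \<in> sets borel" "?E \<in> lmeasurable" "measure lebesgue ?E = \<delta> ^ n"
      using measure_iter_image_lebesgue[OF lmeasurable_unit_cube, of n z] measure_unit_cube[of z]
        sets_iter[OF sets_unit_cube] by simp_all
    have "measure \<mu> ?E \<le> measure \<mu> (periodization ?E)"
      using sets_periodization[OF E(1)] by (intro finite_measure_mono subset_periodization) simp
    also have "\<dots> \<le> measure lebesgue (periodization ?E \<inter> unit_cube 0)"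
      by (intro measure_periodic_le assms sets_periodization E(1) periodic_periodization)
    also have "\<dots> \<le> measure lebesgue ?E"
      by (rule measure_periodization_le[OF E(1,2)])
    finally show ?thesis
      using E(3) by simp
  qed
  show ?thesis
    unfolding energy_def
  proof (rule infsum_le_finite_sums[OF energy_summable])
    fix F assume F: "finite F" "F \<subseteq> Collect (int_vec :: real^'n \<Rightarrow> bool)"
    have "(\<Sum>z\<in>F. (measure \<mu> (iter n ` unit_cube z))\<^sup>2) \<le> (\<Sum>z\<in>F. \<delta> ^ n * measure \<mu> (iter n ` unit_cube z))"
      unfolding power2_eq_square by (intro sum_mono mult_right_mono cube) simp
    also have "\<dots> = \<delta> ^ n * (\<Sum>z\<in>F. measure \<mu> (iter n ` unit_cube z))"
      by (rule sum_distrib_left[symmetric])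
    also have "\<dots> \<le> \<delta> ^ n * 1"
      by (intro mult_left_mono sum_measure_iter_cubes_le_1 F) simp
    finally show "(\<Sum>z\<in>F. (measure \<mu> (iter n ` unit_cube z))\<^sup>2) \<le> \<delta> ^ n"
      by simp
  qed
qed

end

section \<open>The criterion for absolute continuity\<close>

context integral_IFS_transition
begin

lemma absolutely_continuous_iff: "absolutely_continuous lborel \<mu> \<longleftrightarrow> \<rho> = \<delta>"
proof
  assume "\<rho> = \<delta>"
  then show "absolutely_continuous lborel \<mu>"
    using absolutely_continuous_of_energy_le energy_le_power by simp
next
  assume ac: "absolutely_continuous lborel \<mu>"
  obtain c where c: "0 < c" "\<And>n. c * \<rho> ^ n \<le> energy n"
    by (rule energy_ge_power) blast
  have "\<rho> \<le> \<delta>"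
  proof (rule ccontr)
    assume "\<not> \<rho> \<le> \<delta>"
    then have "1 < \<rho> / \<delta>"
      using delta_pos by simp
    \<comment> \<open>A high power of a ratio above 1 outgrows the constant
      \<open>1 / c\<close>.\<close>
    then obtain n where n: "1 / c < (\<rho> / \<delta>) ^ n"
      using real_arch_pow by blast
    have "c * \<rho> ^ n \<le> \<delta> ^ n"
      using c(2) energy_le_of_absolutely_continuous[OF ac] by (rule order_trans)
    then have "(\<rho> / \<delta>) ^ n \<le> 1 / c"
      using c(1) delta_pos by (simp add: power_divide field_simps)
    with n show False by simp
  qed
  \<comment> \<open>This half holds whether or not \<mu> is absolutely continuous.\<close>
  moreover have "\<delta> \<le> \<rho>"
    using delta_le_of_energy_le[OF energy_le_power spectral_radius_pos] .
  ultimately show "\<rho> = \<delta>" by simp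
qed

end

theorem proposition8p1:
  fixes A :: "real^'n^'n" and a :: "nat \<Rightarrow> real^'n" and m N :: nat
    and p :: "nat \<Rightarrow> real" and \<mu> :: "(real^'n) measure"
    and R :: real and v :: "nat \<Rightarrow> real^'n" and M :: "real Matrix.mat"
  assumes "integral_affine_IFS A a m"
    and "onorm ((*v) A) < 1"
    and "\<forall>l\<in>{1..m}. 0 < p l" and "(\<Sum>l=1..m. p l) = 1"
    and "self_affine_measure A a m p \<mu>"
    and "admissible_radius A a m R"
    and "N = card (Omega A a m R)"
    and "bij_betw v {..<N} (Omega A a m R)" and "v 0 = 0"
    and "M = transition_matrix A a m p N v"
  shows "L2_dimension A \<mu> =
           ereal (real CARD('n) * ln (spectral_radius (map_mat complex_of_real M))
                  / ln \<bar>Determinants.det A\<bar>)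
         \<and> (absolutely_continuous lborel \<mu> \<longleftrightarrow>
              spectral_radius (map_mat complex_of_real M) = \<bar>Determinants.det A\<bar>)"
proof -
  interpret integral_IFS_transition A a m p \<mu> R N v M
    using assms by unfold_locales
  show ?thesis
    using L2_dimension_eq absolutely_continuous_iff by simp
qed

end
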